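(* The Fourier transform $\mathcal F_X$ belongs to $\mathrm{End}_G(L^2(X))$ and $$\mathcal F_X=\sum_{0\le r_1,r_2\le n}\ \sum_{s=0}^{N(r_1,r_2)}k_s^{r_1,r_2}\,\widetilde\Lambda_s^{r_1,r_2},\qquad k_s^{r_1,r_2}=(-2)^s\sqrt{\binom{n-2s}{r_2-s}\Big/\binom{n-2s}{r_1-s}}\;P_{r_1-s}(r_2-s,\,n-2s).$$
   Context: Let $\Omega$ be a finite set with $|\Omega|=n\ge1$, $G=S(\Omega)$, $X=\mathcal P(\Omega)$, $X_r=\{x\in X:|x|=r\}$, $G$ acting on $L^2(X)$ (complex functions on $X$ with standard inner product; $L^2(X_r)$ = functions supported on $X_r$) by $(\rho(g)\psi)(x)=\psi(g^{-1}x)$; $\mathrm{End}_G(L^2(X))$ is the algebra of linear endomorphisms commuting with all $\rho(g)$. For $0\le s\le\min(r,n-r)$, $L^2(X_r)_s$ is the unique irreducible $G$-subspace of $L^2(X_r)$ isomorphic to the irreducible representation associated with the partition $(n-s,s)$. $N(r_1,r_2)=\min(r_1,n-r_1,r_2,n-r_2)$. For $0\le s\le N(r_1,r_2)$, $\Lambda_s^{r_1,r_2}$ is a $G$-equivariant map $L^2(X)\to L^2(X)$ sending $L^2(X_{r_1})_s$ into $L^2(X_{r_2})_s$ and vanishing on its orthogonal complement, with kernel $\lambda$ defined on integers $\max(0,r_2-r_1)\le k\le\min(n-r_1,r_2)$ by $(\Lambda_s^{r_1,r_2}\psi)(x_2)=\sum_{x_1\in X_{r_1}}\lambda(|x_2\setminus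 x_1|)\psi(x_1)$; the kernel agrees on its domain with a unique polynomial of degree $s$, nonzero at $0$, and $\Lambda_s^{r_1,r_2}$ is normalized so that this polynomial is $1$ at $t=0$. Set $\widetilde\Lambda_s^{r_1,r_2}=\alpha_s^{r_1,r_2}\Lambda_s^{r_1,r_2}$ with $\alpha_s^{r_1,r_2}=\dfrac{[n-r_1]_s[r_2]_s}{\sqrt{\binom{n-2s}{r_1-s}\binom{n-2s}{r_2-s}}\,s!\,[n-s+1]_s}$, where $[\alpha]_k=\alpha(\alpha-1)\cdots(\alpha-k+1)$. The Fourier transform is $\mathcal F_X\in\mathrm{End}(L^2(X))$, $(\mathcal F_X\psi)(x)=\sum_{x'\in X}(-1)^{|x\cap x'|}\psi(x')$. Krawtchouk polynomials: $P_m(k,N)=\sum_{j=0}^m(-1)^j\binom{k}{j}\binom{N-k}{m-j}$. *)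

theory Defs
  imports "HOL-Computational_Algebra.Polynomial" Complex_Main
begin

text \<open>Omega is the (finite, nonempty) universe of a type 'a :: finite; n = CARD('a).
  X = all subsets of Omega; L^2(X) = functions 'a set => complex.
  G = S(Omega) = bijections of 'a.\<close>

type_synonym 'a L2 = "'a set \<Rightarrow> complex"

definition rho :: "('a \<Rightarrow> 'a) \<Rightarrow> 'a L2 \<Rightarrow> 'a L2" where
  "rho g \<psi> = (\<lambda>x. \<psi> (inv g ` x))"

definition is_clinear :: "('a L2 \<Rightarrow> 'a L2) \<Rightarrow> bool" where
  "is_clinear T \<longleftrightarrow> (\<forall>f h. T (\<lambda>x. f x + h x) = (\<lambda>x. T f x + T h x))
                   \<and> (\<forall>c f. T (\<lambda>x. c * f x) = (\<lambda>x. c * T f x))"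

definition is_equivariant :: "('a L2 \<Rightarrow> 'a L2) \<Rightarrow> bool" where
  "is_equivariant T \<longleftrightarrow> (\<forall>g::'a \<Rightarrow> 'a. bij g \<longrightarrow> (\<forall>\<psi>. T (rho g \<psi>) = rho g (T \<psi>)))"

definition EndG :: "('a::finite L2 \<Rightarrow> 'a L2) set" where
  "EndG = {T. is_clinear T \<and> is_equivariant T}"

definition csubsp :: "'a L2 set \<Rightarrow> bool" where
  "csubsp V \<longleftrightarrow> (\<lambda>x. 0) \<in> V \<and> (\<forall>f\<in>V. \<forall>h\<in>V. (\<lambda>x. f x + h x) \<in> V)
                 \<and> (\<forall>c. \<forall>f\<in>V. (\<lambda>x. c * f x) \<in> V)"

definition G_invariant :: "'a L2 set \<Rightarrow> bool" where
  "G_invariant V \<longleftrightarrow> (\<forall>g::'a \<Rightarrow> 'a. bij g \<longrightarrow> (\<forall>\<psi>\<in>V. rho g \<psi> \<in> V))"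

definition G_subspace :: "'a L2 set \<Rightarrow> bool" where
  "G_subspace V \<longleftrightarrow> csubsp V \<and> G_invariant V"

definition G_irreducible :: "'a L2 set \<Rightarrow> bool" where
  "G_irreducible V \<longleftrightarrow> G_subspace V \<and> V \<noteq> {\<lambda>x. 0}
     \<and> (\<forall>W. W \<subseteq> V \<and> G_subspace W \<longrightarrow> W = {\<lambda>x. 0} \<or> W = V)"

definition G_isomorphic :: "'a L2 set \<Rightarrow> 'a L2 set \<Rightarrow> bool" where
  "G_isomorphic V W \<longleftrightarrow> (\<exists>T. bij_betw T V W
      \<and> (\<forall>f\<in>V. \<forall>h\<in>V. T (\<lambda>x. f x + h x) = (\<lambda>x. T f x + T h x))
      \<and> (\<forall>c. \<forall>f\<in>V. T (\<lambda>x. c * f x) = (\<lambda>x. c * T f x))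
      \<and> (\<forall>g::'a \<Rightarrow> 'a. bij g \<longrightarrow> (\<forall>f\<in>V. T (rho g f) = rho g (T f))))"

text \<open>Specht module S^{(n-s,s)}, realised inside the permutation module
  M^{(n-s,s)} = functions on s-subsets (a tabloid of shape (n-s,s) is identified
  with its second row).  The polytabloid of a tableau whose columns of length 2
  are (a i over b i), i < s, is the signed sum over the column group.\<close>
definition polytabloid :: "nat \<Rightarrow> (nat \<Rightarrow> 'a) \<Rightarrow> (nat \<Rightarrow> 'a) \<Rightarrow> 'a L2" where
  "polytabloid s a b = (\<lambda>x. \<Sum>E\<in>Pow {..<s}.
      if x = (\<lambda>i. if i \<in> E then a i else b i) ` {..<s} then (-1) ^ card E else 0)"

definition specht :: "nat \<Rightarrow> 'a L2 set" where
  "specht s = \<Inter>{W. csubsp W \<and>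
      {polytabloid s a b | a b. inj_on (\<lambda>j. if j < s then a j else b (j - s)) {..<2*s}} \<subseteq> W}"

definition L2_layer :: "nat \<Rightarrow> 'a L2 set" where
  "L2_layer r = {\<psi>. \<forall>x. card x \<noteq> r \<longrightarrow> \<psi> x = 0}"

definition L2_comp :: "nat \<Rightarrow> nat \<Rightarrow> 'a L2 set" where
  "L2_comp r s = (THE V. V \<subseteq> L2_layer r \<and> G_irreducible V \<and> G_isomorphic V (specht s))"

definition inner2 :: "'a::finite L2 \<Rightarrow> 'a L2 \<Rightarrow> complex" where
  "inner2 f h = (\<Sum>x\<in>UNIV. f x * cnj (h x))"

definition orth :: "'a::finite L2 set \<Rightarrow> 'a L2 set" where
  "orth V = {\<psi>. \<forall>\<phi>\<in>V. inner2 \<psi> \<phi> = 0}"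

definition NN :: "nat \<Rightarrow> nat \<Rightarrow> nat \<Rightarrow> nat" where
  "NN n r1 r2 = min (min r1 (n - r1)) (min r2 (n - r2))"

definition Lambda :: "nat \<Rightarrow> nat \<Rightarrow> nat \<Rightarrow> 'a::finite L2 \<Rightarrow> 'a L2" where
  "Lambda r1 r2 s = (THE L. \<exists>p :: complex poly. degree p = s \<and> poly p 0 = 1 \<and>
      L = (\<lambda>\<psi> x2. if card x2 = r2
             then (\<Sum>x1\<in>{x. card x = r1}. poly p (of_nat (card (x2 - x1))) * \<psi> x1) else 0)
      \<and> (\<forall>\<psi>\<in>L2_comp r1 s. L \<psi> \<in> L2_comp r2 s)
      \<and> (\<forall>\<psi>\<in>orth (L2_comp r1 s). L \<psi> = (\<lambda>x. 0)))"

definition ffac :: "real \<Rightarrow> nat \<Rightarrow> real" where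
  "ffac a k = (\<Prod>i<k. a - real i)"

definition alpha :: "nat \<Rightarrow> nat \<Rightarrow> nat \<Rightarrow> nat \<Rightarrow> real" where
  "alpha n r1 r2 s = ffac (real (n - r1)) s * ffac (real r2) s /
     (sqrt (real ((n - 2*s) choose (r1 - s)) * real ((n - 2*s) choose (r2 - s)))
      * fact s * ffac (real (n - s + 1)) s)"

definition Lambda_t :: "nat \<Rightarrow> nat \<Rightarrow> nat \<Rightarrow> 'a::finite L2 \<Rightarrow> 'a L2" where
  "Lambda_t r1 r2 s = (\<lambda>\<psi> x. complex_of_real (alpha (card (UNIV :: 'a set)) r1 r2 s) * Lambda r1 r2 s \<psi> x)"

definition krawtchouk :: "nat \<Rightarrow> nat \<Rightarrow> nat \<Rightarrow> real" where
  "krawtchouk m k N = (\<Sum>j=0..m. (-1) ^ j * real (k choose j) * real ((N - k) choose (m - j)))"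

definition kcoef :: "nat \<Rightarrow> nat \<Rightarrow> nat \<Rightarrow> nat \<Rightarrow> real" where
  "kcoef n r1 r2 s = (-2) ^ s * sqrt (real ((n - 2*s) choose (r2 - s)) / real ((n - 2*s) choose (r1 - s)))
      * krawtchouk (r1 - s) (r2 - s) (n - 2*s)"

definition fourier :: "'a::finite L2 \<Rightarrow> 'a L2" where
  "fourier \<psi> = (\<lambda>x. \<Sum>x'\<in>UNIV. (-1) ^ card (x \<inter> x') * \<psi> x')"

end

theory Submission
  imports Defs "HOL-Combinatorics.Transposition"
begin

text \<open>
  For disjoint pairs \<open>(a\<^sub>i, b\<^sub>i)\<close>, \<open>i < s\<close>, let \<open>tab r s a b\<close> be the function on \<open>X\<^sub>r\<close>
  sending \<open>x\<close> to the product of \<open>[b\<^sub>i \<in> x] - [a\<^sub>i \<in> x]\<close>; for \<open>r = s\<close> it is the polytabloid.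
  A function on \<open>X\<^sub>r\<close> that is skew under the swaps of the pairs and symmetric in the remaining
  points is a multiple of such a tab.  Hence every equivariant map sends a tab of level \<open>r\<^sub>1\<close> to a
  multiple of the corresponding tab of level \<open>r\<^sub>2\<close>, and antisymmetrizing a nonzero function over as
  many disjoint transpositions as possible shows that every nonzero invariant subspace of
  \<open>L\<^sup>2(X\<^sub>r)\<close> contains a tab.  Together with the adjoint, this means that an operator with kernel
  depending on \<open>|x\<^sub>2 \<setminus> x\<^sub>1|\<close> is determined by its eigenvalues on tabs.  Irreducibility
  and uniqueness of \<open>L\<^sup>2(X\<^sub>r)\<^sub>s\<close>, the identification of the kernel of \<open>\<Lambda>\<^sub>s\<close> with a Hahn polynomial,
  and the final formula are obtained by comparing eigenvalues: that of the Fourier transform is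
  \<open>(-2)\<^sup>s\<close> times a Krawtchouk value, that of \<open>\<Lambda>\<^sub>s\<close> on tabs of \<open>t \<noteq> s\<close> pairs is 0.
\<close>

subsection \<open>Products over disjoint pairs\<close>

definition disjoint_pairs :: "nat \<Rightarrow> (nat \<Rightarrow> 'a) \<Rightarrow> (nat \<Rightarrow> 'a) \<Rightarrow> bool" where
  "disjoint_pairs s a b \<longleftrightarrow>
     inj_on a {..<s} \<and> inj_on b {..<s} \<and> a ` {..<s} \<inter> b ` {..<s} = {}"

definition tab :: "nat \<Rightarrow> nat \<Rightarrow> (nat \<Rightarrow> 'a) \<Rightarrow> (nat \<Rightarrow> 'a) \<Rightarrow> 'a L2" where
  "tab r s a b = (\<lambda>x. if card x = r then \<Prod>i<s. of_bool (b i \<in> x) - of_bool (a i \<in> x) else 0)"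

text \<open>Bridges to the definition of \<open>specht\<close>, where the pairs are listed as one
  injective sequence of 2s points. The single sequence is also the easier form for constructing
  pairs and permutations.\<close>

lemma disjoint_pairs_iff:
  "disjoint_pairs s a b \<longleftrightarrow> inj_on (\<lambda>j. if j < s then a j else b (j - s)) {..<2*s}"
proof
  assume h: "disjoint_pairs s a b"
  show "inj_on (\<lambda>j. if j < s then a j else b (j - s)) {..<2*s}"
  proof (rule inj_onI)
    fix i j assume ij: "i \<in> {..<2*s}" "j \<in> {..<2*s}"
      and eq: "(if i < s then a i else b (i - s)) = (if j < s then a j else b (j - s))"
    have I: "inj_on a {..<s}" "inj_on b {..<s}" and D: "a ` {..<s} \<inter> b ` {..<s} = {}"
      using h unfolding disjoint_pairs_def by auto
    consider "i < s" "j < s" | "i < s" "j \<ge> s" | "i \<ge> s" "j < s" | "i \<ge> s" "j \<ge> s"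
      by linarith
    then show "i = j"
    proof cases
      case 1 then show ?thesis using eq I(1) by (auto simp: inj_on_def)
    next
      case 2
      then have "a i = b (j - s)" "i < s" "j - s < s" using eq ij by auto
      then show ?thesis using D by blast
    next
      case 3
      then have "a j = b (i - s)" "j < s" "i - s < s" using eq ij by auto
      then show ?thesis using D by blast
    next
      case 4
      then have "b (i - s) = b (j - s)" "i - s < s" "j - s < s" using eq ij by auto
      then have "i - s = j - s" using I(2) by (auto simp: inj_on_def)
      then show ?thesis using 4 by linarith
    qed
  qed
next
  assume h: "inj_on (\<lambda>j. if j < s then a j else b (j - s)) {..<2*s}"
  have "i = j" if "i < s" "j < s" "a i = a j" for i j
    using inj_onD[OF h, of i j] that by auto
  moreover have "i = j" if "i < s" "j < s" "b i = b j" for i j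
    using inj_onD[OF h, of "i+s" "j+s"] that by auto
  moreover have False if "i < s" "j < s" "a i = b j" for i j
    using inj_onD[OF h, of i "j+s"] that by auto
  ultimately show "disjoint_pairs s a b"
    unfolding disjoint_pairs_def inj_on_def by blast
qed

lemma disjoint_pairsD:
  assumes "disjoint_pairs s a b" "i < s" "j < s"
  shows "a i = a j \<longleftrightarrow> i = j" "b i = b j \<longleftrightarrow> i = j" "a i \<noteq> b j" "b j \<noteq> a i"
proof -
  show "a i = a j \<longleftrightarrow> i = j" "b i = b j \<longleftrightarrow> i = j"
    using assms unfolding disjoint_pairs_def inj_on_def by auto
  show "a i \<noteq> b j" "b j \<noteq> a i"
    using assms unfolding disjoint_pairs_def by (metis IntI empty_iff image_eqI lessThan_iff)+
qed

lemma disjoint_pairs_comp: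
  assumes "disjoint_pairs s a b" "bij g"
  shows "disjoint_pairs s (g \<circ> a) (g \<circ> b)"
proof -
  have "inj g" using assms(2) bij_is_inj by blast
  then have "inj_on g S" for S using inj_on_subset by blast
  then show ?thesis using assms(1) \<open>inj g\<close>
    unfolding disjoint_pairs_def image_comp[symmetric]
    by (auto intro!: comp_inj_on simp flip: image_Int)
qed

lemma disjoint_pairs_extend:
  assumes "disjoint_pairs s a b" "u \<noteq> v"
    "u \<notin> a ` {..<s} \<union> b ` {..<s}" "v \<notin> a ` {..<s} \<union> b ` {..<s}"
  shows "disjoint_pairs (Suc s) (a(s := u)) (b(s := v))"
proof -
  have "{..<s} \<inter> {x. x \<noteq> s} = {..<s}" by auto
  moreover have "inj_on (a(s := u)) {..<s}" "inj_on (b(s := v)) {..<s}"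
    using assms(1) by (auto simp: disjoint_pairs_def inj_on_def)
  ultimately show ?thesis
    using assms unfolding disjoint_pairs_def lessThan_Suc by simp
qed

lemma disjoint_pairs_card:
  assumes "disjoint_pairs s a b"
  shows "card (a ` {..<s}) = s" "card (b ` {..<s}) = s" "card (a ` {..<s} \<union> b ` {..<s}) = 2 * s"
  using assms by (auto simp: disjoint_pairs_def card_image card_Un_disjoint)

lemma disjoint_pairs_bound:
  fixes a :: "nat \<Rightarrow> 'a::finite"
  assumes "disjoint_pairs s a b"
  shows "2 * s \<le> card (UNIV :: 'a set)"
  by (metis assms disjoint_pairs_card(3) card_mono finite top_greatest)

lemma disjoint_pairs_exist:
  assumes "2 * s \<le> card (UNIV :: 'a::finite set)"
  obtains a b :: "nat \<Rightarrow> 'a::finite" where "disjoint_pairs s a b"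
proof -
  obtain f :: "nat \<Rightarrow> 'a" where f: "inj_on f {..<2*s}"
    using assms card_le_inj[of "{..<2*s}" "UNIV :: 'a set"] by auto
  have "disjoint_pairs s f (\<lambda>i. f (i + s))"
    unfolding disjoint_pairs_iff by (rule iffD1[OF inj_on_cong f]) auto
  then show ?thesis using that by blast
qed

text \<open>The matching of the two lists of 2s points extends to all of Omega because the
  complements have equal size. Hence all tabs with s pairs on one level form a single
  G-orbit.\<close>

lemma disjoint_pairs_transitive:
  fixes a b a' b' :: "nat \<Rightarrow> 'a::finite"
  assumes "disjoint_pairs s a b" "disjoint_pairs s a' b'"
  obtains g where "bij g" "\<And>i. i < s \<Longrightarrow> g (a i) = a' i" "\<And>i. i < s \<Longrightarrow> g (b i) = b' i"
proof -
  define c where "c = (\<lambda>j. if j < s then a j else b (j - s))"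
  define c' where "c' = (\<lambda>j. if j < s then a' j else b' (j - s))"
  have inj: "inj_on c {..<2*s}" "inj_on c' {..<2*s}"
    using assms unfolding c_def c'_def disjoint_pairs_iff by auto
  let ?C = "c ` {..<2*s}" and ?C' = "c' ` {..<2*s}"
  define h where "h = c' \<circ> inv_into {..<2*s} c"
  have h: "bij_betw h ?C ?C'"
    unfolding h_def by (rule bij_betw_trans[OF bij_betw_inv_into])
      (use inj in \<open>auto simp: bij_betw_def\<close>)
  have "card ?C = card ?C'" using inj by (simp add: card_image)
  then have "card (- ?C) = card (- ?C')" by (simp add: Compl_eq_Diff_UNIV card_Diff_subset)
  then obtain k where k: "bij_betw k (- ?C) (- ?C')"
    using finite_same_card_bij[of "- ?C" "- ?C'"] by auto
  define g where "g = (\<lambda>x. if x \<in> ?C then h x else k x)"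
  have "bij_betw g (?C \<union> - ?C) (?C' \<union> - ?C')"
  proof (rule bij_betw_combine)
    show "bij_betw g ?C ?C'"
      by (rule iffD1[OF bij_betw_cong h]) (auto simp: g_def)
    show "bij_betw g (- ?C) (- ?C')"
      by (rule iffD1[OF bij_betw_cong k]) (auto simp: g_def)
  qed auto
  then have "bij g" by simp
  moreover have gc: "g (c j) = c' j" if "j < 2*s" for j
    using that inj unfolding g_def h_def by (simp add: inv_into_f_f)
  have "g (a i) = a' i" if "i < s" for i
    using gc[of i] that unfolding c_def c'_def by auto
  moreover have "g (b i) = b' i" if "i < s" for i
    using gc[of "i + s"] that unfolding c_def c'_def by auto
  ultimately show ?thesis using that by blast
qed

section \<open>Values and supports of tabs\<close>

lemma prod_of_bool_diff:
  fixes a b :: "nat \<Rightarrow> 'a"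
  assumes "\<And>i. i < s \<Longrightarrow> a i \<in> x \<longleftrightarrow> b i \<notin> x"
  shows "(\<Prod>i<s. of_bool (b i \<in> x) - of_bool (a i \<in> x) :: complex) = (-1) ^ card {i. i < s \<and> a i \<in> x}"
proof -
  have "(\<Prod>i<s. of_bool (b i \<in> x) - of_bool (a i \<in> x) :: complex) = (\<Prod>i<s. if a i \<in> x then -1 else 1)"
    by (rule prod.cong) (use assms in auto)
  also have "\<dots> = (\<Prod>i\<in>{i. i < s \<and> a i \<in> x}. -1)"
    by (rule prod.mono_neutral_cong_right) auto
  finally show ?thesis by simp
qed

lemma tab_eq_0:
  assumes "i < s" "a i \<in> x \<longleftrightarrow> b i \<in> x"
  shows "tab r s a b x = 0"
  using assms unfolding tab_def by (auto intro!: bexI[of _ i])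

lemma tab_separated:
  assumes "\<And>i. i < s \<Longrightarrow> a i \<in> x \<longleftrightarrow> b i \<notin> x" "card x = r"
  shows "tab r s a b x = (-1) ^ card {i. i < s \<and> a i \<in> x}"
  using prod_of_bool_diff[OF assms(1)] assms(2) unfolding tab_def by simp

lemma tab_nonzeroD:
  assumes "tab r s a b x \<noteq> 0"
  shows "card x = r" "\<And>i. i < s \<Longrightarrow> a i \<in> x \<longleftrightarrow> b i \<notin> x"
  using assms tab_eq_0[of _ s a x b r] by (auto simp: tab_def split: if_splits)

lemma tab_square: "tab r s a b x * tab r s a b x = of_bool (tab r s a b x \<noteq> 0)"
proof (cases "tab r s a b x = 0")
  case False
  then show ?thesis using tab_separated[OF tab_nonzeroD(2,1)[OF False]]
    by (simp flip: power_mult_distrib)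
qed auto

lemma cnj_tab: "cnj (tab r s a b x) = tab r s a b x"
proof -
  have "cnj (of_bool P) = of_bool P" for P by (cases P) auto
  then show ?thesis by (simp add: tab_def)
qed

lemma tab_layer: "tab r s a b \<in> L2_layer r"
  by (simp add: L2_layer_def tab_def)

lemma tab_cong:
  assumes "\<And>i. i < s \<Longrightarrow> a i = a' i" "\<And>i. i < s \<Longrightarrow> b i = b' i"
  shows "tab r s a b = tab r s a' b'"
  using assms by (auto simp: tab_def fun_eq_iff intro!: prod.cong)

lemma mem_inv_image:
  assumes "bij g" shows "y \<in> inv g ` x \<longleftrightarrow> g y \<in> x"
proof
  assume "y \<in> inv g ` x"
  then show "g y \<in> x" using assms by (auto simp: bij_is_surj surj_f_inv_f)
next
  assume "g y \<in> x"
  then have "inv g (g y) \<in> inv g ` x" by blast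
  then show "y \<in> inv g ` x" using assms by (simp add: bij_is_inj)
qed

lemma card_inv_image:
  assumes "bij g" shows "card (inv g ` x) = card x"
  using assms by (meson bij_imp_bij_inv bij_is_inj card_image inj_on_subset subset_UNIV)

lemma rho_tab:
  assumes "bij g"
  shows "rho g (tab r s a b) = tab r s (g \<circ> a) (g \<circ> b)"
  using assms by (simp add: rho_def tab_def mem_inv_image card_inv_image fun_eq_iff)

text \<open>A set in the support contains exactly one point of each pair, so there are at least s
  points inside it and at least s outside.\<close>

lemma tab_nonzero_bound:
  fixes a :: "nat \<Rightarrow> 'a::finite"
  assumes "disjoint_pairs s a b" "tab r s a b x \<noteq> 0"
  shows "s \<le> r" "r + s \<le> card (UNIV :: 'a set)"
proof -
  note D = tab_nonzeroD[OF assms(2)]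
  \<comment> \<open>\<open>?c i\<close> is the point of pair i inside \<open>x\<close>, and
    \<open>?d i\<close> is the one outside.\<close>
  let ?c = "\<lambda>i. if a i \<in> x then a i else b i" and ?d = "\<lambda>i. if a i \<in> x then b i else a i"
  have "inj_on ?c {..<s}" "inj_on ?d {..<s}"
    using disjoint_pairsD[OF assms(1)] by (auto intro!: inj_onI split: if_splits)
  moreover have "?c ` {..<s} \<subseteq> x" "?d ` {..<s} \<subseteq> - x" using D(2) by auto
  ultimately have "s \<le> card x" "s \<le> card (- x)"
    using card_inj_on_le[of ?c "{..<s}" x] card_inj_on_le[of ?d "{..<s}" "- x"] by auto
  moreover have "card (- x) + card x = card (UNIV :: 'a set)"
    by (metis Compl_disjoint2 Compl_partition2 card_Un_disjoint finite)
  ultimately show "s \<le> r" "r + s \<le> card (UNIV :: 'a set)" using D(1) by auto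
qed

text \<open>On such a set the tab has the value 1 (\<open>tab_reference\<close>), so evaluation
  there reads off the scalar of a multiple of a tab.\<close>

lemma reference_set_exists:
  fixes a :: "nat \<Rightarrow> 'a::finite"
  assumes "disjoint_pairs s a b" "s \<le> r" "r + s \<le> card (UNIV :: 'a set)"
  obtains x where "card x = r" "b ` {..<s} \<subseteq> x" "a ` {..<s} \<inter> x = {}"
proof -
  note C = disjoint_pairs_card[OF assms(1)]
  have "card (- a ` {..<s}) = card (UNIV :: 'a set) - s"
    using C by (simp add: Compl_eq_Diff_UNIV card_Diff_subset)
  moreover have "b ` {..<s} \<subseteq> - a ` {..<s}" using assms(1) unfolding disjoint_pairs_def by auto
  ultimately obtain x where "b ` {..<s} \<subseteq> x" "x \<subseteq> - a ` {..<s}" "card x = r"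
    using exists_subset_between[of "b ` {..<s}" r "- a ` {..<s}"] C(2) assms(2,3) by fastforce
  then show ?thesis using that by blast
qed

lemma tab_reference:
  assumes "card x = r" "b ` {..<s} \<subseteq> x" "a ` {..<s} \<inter> x = {}"
  shows "tab r s a b x = 1"
proof -
  have "{i. i < s \<and> a i \<in> x} = {}" using assms by auto
  moreover have "\<And>i. i < s \<Longrightarrow> a i \<in> x \<longleftrightarrow> b i \<notin> x" using assms by auto
  ultimately show ?thesis using tab_separated[of s a x b r] assms(1) by (simp del: Collect_empty_eq)
qed

text \<open>The sets in the signed sum choose one point from every pair. These are exactly the
  s-sets that separate all pairs, and E is recovered as the set of indices i with \<open>a i\<close>
  in the set, so the signs agree.\<close>

lemma polytabloid_eq_tab:
  fixes a :: "nat \<Rightarrow> 'a::finite"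
  assumes "disjoint_pairs s a b"
  shows "polytabloid s a b = tab s s a b"
proof
  fix x
  define img where "img = (\<lambda>E. (\<lambda>i. if i \<in> E then a i else b i) ` {..<s})"
  note D = disjoint_pairsD[OF assms]
  have inj: "inj_on (\<lambda>i. if i \<in> E then a i else b i) {..<s}" for E
    using D by (auto intro!: inj_onI split: if_splits)
  have card: "card (img E) = s" for E unfolding img_def using card_image[OF inj[of E]] by simp
  have mem: "a i \<in> img E \<longleftrightarrow> i \<in> E" "b i \<in> img E \<longleftrightarrow> i \<notin> E" if "i < s" for i E
    using D that unfolding img_def by (auto simp: image_iff)
  have P: "polytabloid s a b x = (\<Sum>E\<in>Pow {..<s}. if x = img E then (-1) ^ card E else 0)"
    unfolding polytabloid_def img_def ..
  show "polytabloid s a b x = tab s s a b x"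
  proof (cases "\<exists>E\<in>Pow {..<s}. x = img E")
    case True
    then obtain E where E: "E \<subseteq> {..<s}" "x = img E" by auto
    have uniq: "F = E" if "F \<subseteq> {..<s}" "img F = img E" for F
    proof -
      have "i \<in> F \<longleftrightarrow> i \<in> E" if "i < s" for i
        using mem(1)[OF that, of F] mem(1)[OF that, of E] \<open>img F = img E\<close> by simp
      then show ?thesis using \<open>F \<subseteq> {..<s}\<close> E(1) by auto
    qed
    have "polytabloid s a b x = (\<Sum>E'\<in>{E}. (-1) ^ card E')"
      unfolding P by (rule sum.mono_neutral_cong_right) (use E uniq in auto)
    moreover have "{i. i < s \<and> a i \<in> x} = E" using E mem by auto
    ultimately show ?thesis using tab_separated[of s a x b s] mem E card by simp
  next
    case False
    have "tab s s a b x = 0"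
    proof (rule ccontr)
      assume nz: "tab s s a b x \<noteq> 0"
      note T = tab_nonzeroD[OF nz]
      let ?E = "{i. i < s \<and> a i \<in> x}"
      have "img ?E \<subseteq> x" using T(2) unfolding img_def by auto
      \<comment> \<open>A separating set contains its own transversal; both have s elements.\<close>
      then have "img ?E = x" using card_subset_eq[of x "img ?E"] T(1) card[of ?E] by simp
      then show False using False by blast
    qed
    moreover have "polytabloid s a b x = 0" unfolding P by (rule sum.neutral) (use False in auto)
    ultimately show ?thesis by simp
  qed
qed

subsection \<open>Skew functions\<close>

definition skew :: "nat \<Rightarrow> (nat \<Rightarrow> 'a) \<Rightarrow> (nat \<Rightarrow> 'a) \<Rightarrow> 'a L2 \<Rightarrow> bool" where
  "skew s a b f \<longleftrightarrow> (\<forall>i<s. \<forall>x. f (transpose (a i) (b i) ` x) = - f x)"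

definition symmetric_off :: "nat \<Rightarrow> (nat \<Rightarrow> 'a) \<Rightarrow> (nat \<Rightarrow> 'a) \<Rightarrow> 'a L2 \<Rightarrow> bool" where
  "symmetric_off s a b f \<longleftrightarrow> (\<forall>u v. u \<notin> a ` {..<s} \<union> b ` {..<s} \<longrightarrow>
     v \<notin> a ` {..<s} \<union> b ` {..<s} \<longrightarrow> (\<forall>x. f (transpose u v ` x) = f x))"

lemma bij_inv_image:
  fixes g :: "'a \<Rightarrow> 'a"
  assumes "bij g"
  shows "bij ((`) (inv g))"
proof -
  have "inv g ` g ` x = x" "g ` inv g ` x = x" for x
    using assms by (auto simp: image_image bij_is_inj bij_is_surj surj_f_inv_f)
  then show ?thesis by (intro o_bij[of "(`) g"]) auto
qed

lemma csubsp_add: "csubsp W \<Longrightarrow> f \<in> W \<Longrightarrow> h \<in> W \<Longrightarrow> (\<lambda>x. f x + h x) \<in> W"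
  and csubsp_scale: "csubsp W \<Longrightarrow> f \<in> W \<Longrightarrow> (\<lambda>x. c * f x) \<in> W"
  by (simp_all add: csubsp_def)

lemma G_subspace_rho: "G_subspace W \<Longrightarrow> bij g \<Longrightarrow> f \<in> W \<Longrightarrow> rho g f \<in> W"
  by (simp add: G_subspace_def G_invariant_def)

lemma rho_transpose: "rho (transpose u v) f = (\<lambda>x. f (transpose u v ` x))"
  by (simp add: rho_def)

lemma tab_swap_pair:
  assumes "i < s"
  shows "tab r s (a(i := b i)) (b(i := a i)) x = - tab r s a b x"
proof -
  let ?t = "\<lambda>a b j. of_bool (b j \<in> x) - of_bool (a j \<in> x) :: complex"
  have "(\<Prod>j<s. ?t (a(i := b i)) (b(i := a i)) j) = ?t b a i * (\<Prod>j\<in>{..<s}-{i}. ?t (a(i := b i)) (b(i := a i)) j)"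
    using assms by (simp add: prod.remove[of "{..<s}" i])
  also have "(\<Prod>j\<in>{..<s}-{i}. ?t (a(i := b i)) (b(i := a i)) j) = (\<Prod>j\<in>{..<s}-{i}. ?t a b j)"
    by (rule prod.cong) auto
  also have "?t b a i * \<dots> = - (?t a b i * (\<Prod>j\<in>{..<s}-{i}. ?t a b j))" by (simp add: algebra_simps)
  also have "?t a b i * (\<Prod>j\<in>{..<s}-{i}. ?t a b j) = (\<Prod>j<s. ?t a b j)"
    using assms by (simp add: prod.remove[of "{..<s}" i])
  finally show ?thesis by (simp add: tab_def)
qed

lemma skew_tab:
  assumes "disjoint_pairs s a b"
  shows "skew s a b (tab r s a b)"
  unfolding skew_def
proof (intro allI impI)
  fix i x assume i: "i < s"
  let ?g = "transpose (a i) (b i)"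
  have "tab r s a b (?g ` x) = tab r s (?g \<circ> a) (?g \<circ> b) x"
    using rho_tab[of ?g r s a b] by (simp add: rho_transpose fun_eq_iff)
  also have "\<dots> = tab r s (a(i := b i)) (b(i := a i)) x"
    by (rule fun_cong[OF tab_cong]) (use i disjoint_pairsD[OF assms] in \<open>auto simp: transpose_def\<close>)
  also have "\<dots> = - tab r s a b x" by (rule tab_swap_pair[OF i])
  finally show "tab r s a b (?g ` x) = - tab r s a b x" .
qed

lemma symmetric_off_tab:
  "symmetric_off s a b (tab r s a b)"
  unfolding symmetric_off_def
proof (intro allI impI)
  fix u v x
  assume u: "u \<notin> a ` {..<s} \<union> b ` {..<s}" and v: "v \<notin> a ` {..<s} \<union> b ` {..<s}"
  let ?g = "transpose u v"
  have "tab r s a b (?g ` x) = tab r s (?g \<circ> a) (?g \<circ> b) x"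
    using rho_tab[of ?g r s a b] by (simp add: rho_transpose fun_eq_iff)
  also have "\<dots> = tab r s a b x"
    by (rule fun_cong[OF tab_cong]) (use u v in \<open>auto simp: transpose_def\<close>)
  finally show "tab r s a b (?g ` x) = tab r s a b x" .
qed

text \<open>If a pair is not separated, its swap maps \<open>x\<close> to itself, so f x = - f
  x.\<close>

lemma skew_eq_0:
  assumes "skew s a b f" "i < s" "a i \<in> x \<longleftrightarrow> b i \<in> x"
  shows "f x = 0"
proof -
  have "f (transpose (a i) (b i) ` x) = - f x" using assms(1,2) unfolding skew_def by blast
  then show ?thesis using assms(3) by simp
qed

text \<open>Provides the decrease of \<open>card (x - y)\<close> in the induction that joins two
  sets by swaps.\<close>

lemma transpose_diff_psubset:
  fixes x y :: "'a::finite set"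
  assumes "u \<in> x" "v \<notin> x" "u \<notin> y"
  shows "card (transpose u v ` x - y) < card (x - y) \<or> (v \<notin> y)"
proof -
  have "transpose u v ` x = insert v (x - {u})"
    using assms by (auto simp: transpose_def image_iff split: if_splits)
  then have "v \<in> y \<Longrightarrow> transpose u v ` x - y \<subset> x - y" using assms by auto
  then show ?thesis using psubset_card_mono[of "x - y"] by auto
qed

text \<open>Two separating sets of equal size are joined by swaps of pairs and swaps off the pairs,
  each of which multiplies both functions by the same sign.\<close>

lemma skew_symmetric_proportional:
  fixes f h :: "'a::finite L2"
  assumes f: "skew s a b f" "symmetric_off s a b f"
    and h: "skew s a b h" "symmetric_off s a b h"
    and "card x = card y" "\<And>i. i < s \<Longrightarrow> a i \<in> x \<longleftrightarrow> b i \<notin> x" "\<And>i. i < s \<Longrightarrow> a i \<in> y \<longleftrightarrow> b i \<notin> y"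
    and D: "disjoint_pairs s a b"
  shows "f x * h y = f y * h x"
  using assms(5,6)
proof (induction "card (x - y)" arbitrary: x rule: less_induct)
  case less
  \<comment> \<open>One swap of u and v multiplies both functions by the same sign e. The induction
    hypothesis for the swapped set then carries the factor e * e = 1 on both sides.\<close>
  have step: ?case
    if "u \<in> x" "v \<notin> x" "u \<notin> y" "v \<in> y" "e * e = 1"
      "f (transpose u v ` x) = e * f x" "h (transpose u v ` x) = e * h x"
      "\<And>i. i < s \<Longrightarrow> a i \<in> transpose u v ` x \<longleftrightarrow> b i \<notin> transpose u v ` x"
    for u v and e :: complex
  proof -
    let ?x = "transpose u v ` x"
    have "card (?x - y) < card (x - y)" using transpose_diff_psubset[OF that(1-3)] that(4) by blast
    moreover have "card ?x = card y" using less.prems(1) by (simp add: card_image)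
    ultimately have "f ?x * h y = f y * h ?x" using less.hyps that(8) by blast
    then have "e * e * (f x * h y) = e * e * (f y * h x)" unfolding that(6,7) by (simp add: algebra_simps)
    then show ?thesis using that(5) by simp
  qed
  have pair: "a j \<in> transpose (a i) (b i) ` x \<longleftrightarrow> b j \<notin> transpose (a i) (b i) ` x"
    if "i < s" "j < s" for i j
    using less.prems(2)[OF that(2)] less.prems(2)[OF that(1)] disjoint_pairsD[OF D that(1,2)] 
      disjoint_pairsD[OF D that(2,1)]
    by (cases "i = j") (auto simp: in_transpose_image_iff)
  \<comment> \<open>A pair on which \<open>x\<close> and \<open>y\<close> disagree is swapped with
    sign -1; which of its points plays the role of u depends on whether \<open>a i\<close> lies in
    \<open>x\<close>.\<close>
  have pair_step: ?case if i: "i < s" and ne: "a i \<in> x \<longleftrightarrow> a i \<notin> y" for i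
  proof -
    have sg: "f (transpose (a i) (b i) ` x) = -1 * f x" "h (transpose (a i) (b i) ` x) = -1 * h x"
      using f(1) h(1) i unfolding skew_def by simp_all
    show ?thesis
    proof (cases "a i \<in> x")
      case True
      then show ?thesis
        using step[OF _ _ _ _ _ sg pair[OF i]] ne less.prems(2)[OF i] assms(7)[OF i] by auto
    next
      case False
      then show ?thesis
        using step[of "b i" "a i" "-1", unfolded transpose_commute[of "b i" "a i"], OF _ _ _ _ _ sg pair[OF i]]
          ne less.prems(2)[OF i] assms(7)[OF i] by auto
    qed
  qed
  show ?case
  proof (cases "x - y = {}")
    case True
    then have "x = y" using less.prems(1) by (simp add: card_subset_eq)
    then show ?thesis by simp
  next
    case False
    then obtain u where u: "u \<in> x" "u \<notin> y" by auto
    show ?thesis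
    proof (cases "u \<in> a ` {..<s} \<union> b ` {..<s}")
      case True
      then obtain i where "i < s" "u = a i \<or> u = b i" by auto
      then show ?thesis
        using pair_step[of i] less.prems(2)[of i] assms(7)[of i] u by blast
    next
      case off: False
      show ?thesis
      proof (cases "\<exists>v\<in>y - x. v \<in> a ` {..<s} \<union> b ` {..<s}")
        case True
        then obtain v i where "v \<in> y" "v \<notin> x" "i < s" "v = a i \<or> v = b i" by auto
        then show ?thesis
          using pair_step[of i] less.prems(2)[of i] assms(7)[of i] by blast
      next
        case offv: False
        \<comment> \<open>From here on both u and the point v to be chosen lie off all pairs, so the
          swap acts with sign 1.\<close>
        have "y - x \<noteq> {}" using less.prems(1) u by (metis Diff_eq_empty_iff card_subset_eq finite)
        then obtain v where v: "v \<in> y" "v \<notin> x" by auto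
        then have v': "v \<notin> a ` {..<s} \<union> b ` {..<s}" using offv by blast
        have inv: "f (transpose u v ` x) = 1 * f x" "h (transpose u v ` x) = 1 * h x"
          using f(2) h(2) off v' unfolding symmetric_off_def by simp_all
        have "a i \<in> transpose u v ` x \<longleftrightarrow> b i \<notin> transpose u v ` x" if "i < s" for i
        proof -
          have "a i \<noteq> u" "a i \<noteq> v" "b i \<noteq> u" "b i \<noteq> v" using off v' that by auto
          then show ?thesis using less.prems(2)[OF that] by (simp add: in_transpose_image_iff)
        qed
        then show ?thesis using step[OF u(1) v(2) u(2) v(1) _ inv] by simp
      qed
    qed
  qed
qed

text \<open>Off the separating r-sets both functions vanish, and on these sets they are
  proportional; one point of the support of the tab fixes the factor. If the tab vanishes
  identically, there is no separating r-set and f is 0.\<close>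

lemma skew_symmetric_eq_tab:
  fixes f :: "'a::finite L2"
  assumes D: "disjoint_pairs s a b" and "f \<in> L2_layer r" and f: "skew s a b f" "symmetric_off s a b f"
  shows "\<exists>c. f = (\<lambda>x. c * tab r s a b x)"
proof (cases "\<exists>y. tab r s a b y \<noteq> 0")
  case True
  then obtain y where y: "tab r s a b y \<noteq> 0" by blast
  have "f x = f y / tab r s a b y * tab r s a b x" for x
  proof (cases "card x = r \<and> (\<forall>i<s. a i \<in> x \<longleftrightarrow> b i \<notin> x)")
    case True
    have "f x * tab r s a b y = f y * tab r s a b x"
      by (rule skew_symmetric_proportional[OF f skew_tab[OF D] symmetric_off_tab _ _ _ D])
        (use True tab_nonzeroD[OF y] in auto)
    then show ?thesis using y by (simp add: field_simps)
  next
    case False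
    then have "f x = 0" using assms(2) skew_eq_0[OF f(1)] unfolding L2_layer_def by blast
    moreover have "tab r s a b x = 0" using False tab_nonzeroD[of r s a b x] by blast
    ultimately show ?thesis by simp
  qed
  then show ?thesis by blast
next
  case False
  have "f x = 0" for x
  proof (rule ccontr)
    assume "f x \<noteq> 0"
    then have "card x = r" "\<And>i. i < s \<Longrightarrow> a i \<in> x \<longleftrightarrow> b i \<notin> x"
      using assms(2) skew_eq_0[OF f(1)] unfolding L2_layer_def by blast+
    then show False using False tab_separated[of s a x b r] by simp
  qed
  then show ?thesis by (auto intro!: exI[of _ 0])
qed

text \<open>Bilinear rather than Hermitian, so that scalars and adjoints involve no conjugation.
  Tabs are real, so against a tab it coincides with \<open>inner2\<close>.\<close>

definition pairing :: "'a::finite L2 \<Rightarrow> 'a L2 \<Rightarrow> complex" where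
  "pairing f h = (\<Sum>x\<in>UNIV. f x * h x)"

lemma pairing_rho:
  assumes "bij g"
  shows "pairing (rho g f) (rho g h) = pairing f h"
  unfolding pairing_def rho_def
  by (rule sum.reindex_bij_betw[OF bij_inv_image[OF assms], of "\<lambda>x. f x * h x"])

lemma pairing_transpose:
  "pairing (\<lambda>x. f (transpose u v ` x)) h = pairing f (\<lambda>x. h (transpose u v ` x))"
proof -
  have "transpose u v ` transpose u v ` x = x" for x by (simp add: image_image)
  then show ?thesis
    using pairing_rho[of "transpose u v" f "\<lambda>x. h (transpose u v ` x)"] by (simp add: rho_transpose)
qed

text \<open>The values of a tab are 0, 1 and -1, so this pairing counts its support.\<close>

lemma pairing_tab_self: 
  assumes "tab r s a b x \<noteq> 0"
  shows "pairing (tab r s a b) (tab r s a b) \<noteq> 0"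
proof -
  have "pairing (tab r s a b) (tab r s a b) = of_nat (card {x. tab r s a b x \<noteq> 0})"
    unfolding pairing_def tab_square by (simp add: sum.If_cases of_bool_def)
  then show ?thesis using assms by (auto simp: card_eq_0_iff)
qed

text \<open>Antisymmetrize over as many disjoint transpositions as possible without reaching 0:
  the result is symmetric in the remaining points, hence proportional to a tab.\<close>

lemma tab_in_invariant_subspace:
  fixes f :: "'a::finite L2"
  assumes W: "G_subspace W" "W \<subseteq> L2_layer r" and f: "f \<in> W" "f y \<noteq> 0"
  obtains s a b x where "disjoint_pairs s a b" "tab r s a b \<in> W" "tab r s a b x \<noteq> 0"
    "pairing f (tab r s a b) \<noteq> 0"
proof -
  \<comment> \<open>g is f antisymmetrized over s pairs. The last clause keeps the link to f:
    against skew functions, g pairs like f up to the factor 2^s.\<close>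
  define Q where "Q s \<longleftrightarrow> (\<exists>a b g. disjoint_pairs s a b \<and> g \<in> W \<and> (\<exists>x. g x \<noteq> 0) \<and> skew s a b g \<and>
     (\<forall>h. skew s a b h \<longrightarrow> pairing g h = 2 ^ s * pairing f h))" for s
  have "Q 0" unfolding Q_def disjoint_pairs_def skew_def using f by auto
  moreover have "s \<le> card (UNIV :: 'a set)" if "Q s" for s
    using that disjoint_pairs_bound unfolding Q_def by fastforce
  \<comment> \<open>\<open>Q\<close> holds at 0 and fails beyond n, so there is a last s before a
    failure.\<close>
  ultimately obtain s where s: "Q s" "\<not> Q (Suc s)"
    using nat_induct[of Q "Suc (card (UNIV :: 'a set))"] not_less_eq_eq by blast
  then obtain a b g where g: "disjoint_pairs s a b" "g \<in> W" "\<exists>x. g x \<noteq> 0" "skew s a b g"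
    "\<And>h. skew s a b h \<Longrightarrow> pairing g h = 2 ^ s * pairing f h" unfolding Q_def by blast
  have "symmetric_off s a b g"
  proof (rule ccontr)
    assume "\<not> symmetric_off s a b g"
    then obtain u v z where u: "u \<notin> a ` {..<s} \<union> b ` {..<s}" and v: "v \<notin> a ` {..<s} \<union> b ` {..<s}"
      and z: "g (transpose u v ` z) \<noteq> g z" unfolding symmetric_off_def by blast
    then have uv: "u \<noteq> v" by auto
    \<comment> \<open>Antisymmetrization over one more pair (u, v). It is nonzero at z by the
      failure of symmetry, and it stays skew in the old pairs because disjoint transpositions
      commute.\<close>
    define g' where "g' = (\<lambda>x. g x + (-1) * rho (transpose u v) g x)"
    let ?a = "a(s := u)" and ?b = "b(s := v)"
    have "disjoint_pairs (Suc s) ?a ?b" by (rule disjoint_pairs_extend[OF g(1) uv u v])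
    moreover have "g' \<in> W"
      unfolding g'_def using W(1) g(2) by (intro csubsp_add csubsp_scale G_subspace_rho) (auto simp: G_subspace_def)
    moreover have "g' z \<noteq> 0" using z[symmetric] unfolding g'_def by (simp add: rho_transpose)
    moreover have "skew (Suc s) ?a ?b g'"
      unfolding skew_def
    proof (intro allI impI)
      fix i x assume "i < Suc s"
      then consider "i = s" | "i < s" by linarith
      then show "g' (transpose (?a i) (?b i) ` x) = - g' x"
      proof cases
        case 1 then show ?thesis by (simp add: g'_def rho_transpose image_image)
      next
        case 2
        then have "a i \<noteq> u" "a i \<noteq> v" "b i \<noteq> u" "b i \<noteq> v" using u v by auto
        then have "transpose u v ` transpose (a i) (b i) ` x = transpose (a i) (b i) ` transpose u v ` x"
          unfolding image_image by (intro image_cong) (auto simp: transpose_def)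
        moreover have "g (transpose (a i) (b i) ` x) = - g x" for x using g(4) 2 unfolding skew_def by blast
        ultimately show ?thesis using 2 by (simp add: g'_def rho_transpose)
      qed
    qed
    moreover have "pairing g' h = 2 ^ Suc s * pairing f h" if h: "skew (Suc s) ?a ?b h" for h
    proof -
      have "h (transpose u v ` x) = - h x" for x using h[unfolded skew_def, rule_format, of s x] by simp
      \<comment> \<open>Moving the swap to the other argument produces a minus sign, so the two
        halves of g' contribute equally; this is the new factor 2.\<close>
      then have "pairing (\<lambda>x. g (transpose u v ` x)) h = - pairing g h"
        unfolding pairing_transpose by (simp add: pairing_def sum_negf)
      then have "pairing g' h = 2 * pairing g h"
        by (simp add: g'_def rho_transpose pairing_def algebra_simps sum.distrib sum_subtractf)
      moreover have "skew s a b h" unfolding skew_def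
      proof (intro allI impI)
        fix i x assume "i < s"
        then show "h (transpose (a i) (b i) ` x) = - h x"
          using h[unfolded skew_def, rule_format, of i x] by simp
      qed
      ultimately show ?thesis using g(5) by simp
    qed
    ultimately have "Q (Suc s)" unfolding Q_def by blast
    then show False using s(2) by blast
  qed
  then obtain c where c: "g = (\<lambda>x. c * tab r s a b x)"
    using skew_symmetric_eq_tab[OF g(1) _ g(4)] g(2) W(2) by blast
  have "c \<noteq> 0" using g(3) c by auto
  moreover have "(\<lambda>x. (1/c) * g x) \<in> W"
    using W(1) g(2) csubsp_scale unfolding G_subspace_def by blast
  ultimately have "tab r s a b \<in> W" by (simp add: c)
  moreover obtain x where x: "tab r s a b x \<noteq> 0" using g(3) c by auto
  moreover have "pairing f (tab r s a b) \<noteq> 0"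
  proof
    assume "pairing f (tab r s a b) = 0"
    then have "pairing g (tab r s a b) = 0" using g(5) skew_tab[OF g(1)] by simp
    moreover have "pairing g (tab r s a b) = c * pairing (tab r s a b) (tab r s a b)"
      by (simp add: c pairing_def sum_distrib_left mult.assoc)
    ultimately show False using \<open>c \<noteq> 0\<close> pairing_tab_self[OF x] by simp
  qed
  ultimately show ?thesis using that g(1) by blast
qed

subsection \<open>Operators with kernel depending on a set difference\<close>

text \<open>The shape of the operators in \<open>Lambda\<close>, with an arbitrary kernel, so that
  Hahn, binomial and sign kernels are treated together.\<close>

definition layer_op :: "(nat \<Rightarrow> complex) \<Rightarrow> nat \<Rightarrow> nat \<Rightarrow> 'a::finite L2 \<Rightarrow> 'a L2" where
  "layer_op m r1 r2 = (\<lambda>\<psi> x2. if card x2 = r2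
     then (\<Sum>x1\<in>{x. card x = r1}. m (card (x2 - x1)) * \<psi> x1) else 0)"

lemma layer_op_add: "layer_op m r1 r2 (\<lambda>x. f x + h x) = (\<lambda>x. layer_op m r1 r2 f x + layer_op m r1 r2 h x)"
  by (auto simp: layer_op_def algebra_simps sum.distrib)

lemma layer_op_scale: "layer_op m r1 r2 (\<lambda>x. c * f x) = (\<lambda>x. c * layer_op m r1 r2 f x)"
  by (auto simp: layer_op_def algebra_simps sum_distrib_left)

lemma layer_op_layer: "layer_op m r1 r2 f \<in> L2_layer r2"
  by (simp add: L2_layer_def layer_op_def)

lemma layer_op_rho:
  assumes "bij g"
  shows "layer_op m r1 r2 (rho g f) = rho g (layer_op m r1 r2 f)"
proof
  fix x
  have inj: "inj (inv g)" using assms bij_imp_bij_inv bij_is_inj by blast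
  have "bij_betw ((`) (inv g)) {x. card x = r1} {x. card x = r1}"
  proof (rule bij_betw_imageI)
    show "inj_on ((`) (inv g)) {x. card x = r1}"
      by (rule inj_on_subset[OF bij_is_inj[OF bij_inv_image[OF assms]] subset_UNIV])
    have "x \<in> (`) (inv g) ` {x. card x = r1}" if "card x = r1" for x
    proof -
      obtain y where "x = inv g ` y" using bij_is_surj[OF bij_inv_image[OF assms]] by (rule surjE)
      then show ?thesis using that card_inv_image[OF assms, of y] by simp
    qed
    then show "(`) (inv g) ` {x. card x = r1} = {x. card x = r1}"
      using card_inv_image[OF assms] by auto
  qed
  then have "(\<Sum>x1\<in>{x. card x = r1}. m (card (inv g ` x - inv g ` x1)) * f (inv g ` x1)) =
      (\<Sum>x1\<in>{x. card x = r1}. m (card (inv g ` x - x1)) * f x1)"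
    by (rule sum.reindex_bij_betw)
  moreover have "card (inv g ` x - inv g ` x1) = card (x - x1)" for x1
    using card_inv_image[OF assms, of "x - x1"] by (simp add: image_set_diff[OF inj])
  ultimately show "layer_op m r1 r2 (rho g f) x = rho g (layer_op m r1 r2 f) x"
    by (simp add: layer_op_def rho_def card_inv_image[OF assms])
qed

lemma layer_op_uminus: "layer_op m r1 r2 (\<lambda>x. - f x) = (\<lambda>x. - layer_op m r1 r2 f x)"
  using layer_op_scale[of m r1 r2 "-1" f] by simp

text \<open>Equivariance carries skewness and symmetry off the pairs over to level
  \<open>r2\<close>, where only multiples of the tab have both. This plays the part of Schur's
  lemma.\<close>

lemma layer_op_tab_ex:
  assumes "disjoint_pairs s a b"
  shows "\<exists>c. layer_op m r1 r2 (tab r1 s a b) = (\<lambda>x. c * tab r2 s a b x)"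
proof (rule skew_symmetric_eq_tab[OF assms layer_op_layer])
  let ?f = "tab r1 s a b"
  have eq: "layer_op m r1 r2 ?f (transpose u v ` x) = layer_op m r1 r2 (\<lambda>x. ?f (transpose u v ` x)) x" for u v x
    using layer_op_rho[of "transpose u v" m r1 r2 ?f] by (simp add: rho_transpose fun_eq_iff)
  show "skew s a b (layer_op m r1 r2 ?f)"
    using skew_tab[OF assms, of r1] unfolding skew_def eq by (simp add: layer_op_uminus)
  show "symmetric_off s a b (layer_op m r1 r2 ?f)"
    using symmetric_off_tab[of s a b r1] unfolding symmetric_off_def eq by simp
qed

text \<open>The two differences satisfy |x2 - x1| = |x1 - x2| + r2 - r1. The addition comes first,
  so the subtraction is not truncated on the sets concerned.\<close>

lemma layer_op_adjoint:
  "pairing (layer_op m r1 r2 f) h = pairing f (layer_op (\<lambda>k. m (k + r2 - r1)) r2 r1 h)"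
proof -
  have c: "card (x2 - x1) = card (x1 - x2) + r2 - r1" if "card x1 = r1" "card x2 = r2" for x1 x2 :: "'a set"
    using card_Diff_subset_Int[of x1 x2] card_Diff_subset_Int[of x2 x1]
      card_mono[of x1 "x1 \<inter> x2"] card_mono[of x2 "x2 \<inter> x1"] that by (simp add: Int_commute)
  have "pairing (layer_op m r1 r2 f) h =
      (\<Sum>x2\<in>{x. card x = r2}. \<Sum>x1\<in>{x. card x = r1}. m (card (x2 - x1)) * f x1 * h x2)"
    unfolding pairing_def layer_op_def
    by (rule sum.mono_neutral_cong_right) (auto simp: sum_distrib_right)
  also have "\<dots> = (\<Sum>x1\<in>{x. card x = r1}. \<Sum>x2\<in>{x. card x = r2}. m (card (x2 - x1)) * f x1 * h x2)"
    by (rule sum.swap)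
  also have "\<dots> = pairing f (layer_op (\<lambda>k. m (k + r2 - r1)) r2 r1 h)"
    unfolding pairing_def layer_op_def
    by (rule sum.mono_neutral_cong_left) (auto simp: sum_distrib_left c algebra_simps intro!: sum.cong)
  finally show ?thesis .
qed

section \<open>Detection of layer operators by tabs\<close>

lemma G_subspace_layer: "G_subspace (L2_layer r :: 'a::finite L2 set)"
  by (auto simp: G_subspace_def csubsp_def G_invariant_def L2_layer_def rho_def card_inv_image)

lemma pairing_scale: "pairing (\<lambda>x. c * f x) h = c * pairing f h" "pairing f (\<lambda>x. c * h x) = c * pairing f h"
  by (simp_all add: pairing_def sum_distrib_left algebra_simps)

text \<open>Some tab of level \<open>r2\<close> pairs nontrivially with the image of f. Moved
  through the adjoint, this pairing becomes c times the pairing of f with the tab of level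
  \<open>r1\<close>, so c is nonzero. The same c then shows that the operator does not kill that
  tab.\<close>

lemma layer_op_detected_by_tab:
  fixes f :: "'a::finite L2"
  assumes "layer_op m r1 r2 f y \<noteq> 0"
  obtains s a b x where "disjoint_pairs s a b" "pairing f (tab r1 s a b) \<noteq> 0"
    "layer_op m r1 r2 (tab r1 s a b) x \<noteq> 0"
proof -
  obtain s a b where D: "disjoint_pairs s a b"
    and nz: "pairing (layer_op m r1 r2 f) (tab r2 s a b) \<noteq> 0"
    using tab_in_invariant_subspace[OF G_subspace_layer order_refl layer_op_layer assms] by metis
  let ?m = "\<lambda>k. m (k + r2 - r1)"
  obtain c where c: "layer_op ?m r2 r1 (tab r2 s a b) = (\<lambda>x. c * tab r1 s a b x)"
    using layer_op_tab_ex[OF D] by blast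
  have "c \<noteq> 0" and p: "pairing f (tab r1 s a b) \<noteq> 0"
    using nz unfolding layer_op_adjoint c pairing_scale by auto
  obtain z where z: "tab r1 s a b z \<noteq> 0"
    using p unfolding pairing_def by (metis (no_types, lifting) mult_zero_right sum.neutral)
  have "pairing (layer_op m r1 r2 (tab r1 s a b)) (tab r2 s a b) \<noteq> 0"
    unfolding layer_op_adjoint c pairing_scale using \<open>c \<noteq> 0\<close> pairing_tab_self[OF z] by simp
  then obtain x where "layer_op m r1 r2 (tab r1 s a b) x \<noteq> 0"
    unfolding pairing_def by (metis (no_types, lifting) mult_zero_left sum.neutral)
  then show ?thesis using that D p by blast
qed

text \<open>The tab must be nonzero on both levels, which gives the support bounds for
  \<open>r1\<close> and for \<open>r2\<close>.\<close>

lemma layer_op_tab_nonzero_bound: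
  fixes a :: "nat \<Rightarrow> 'a::finite"
  assumes "disjoint_pairs s a b" "layer_op m r1 r2 (tab r1 s a b) x \<noteq> 0"
  shows "s \<le> NN (card (UNIV :: 'a set)) r1 r2"
proof -
  obtain c where "layer_op m r1 r2 (tab r1 s a b) = (\<lambda>x. c * tab r2 s a b x)"
    using layer_op_tab_ex[OF assms(1)] by blast
  then have "tab r2 s a b x \<noteq> 0" using assms(2) by auto
  moreover obtain y where "tab r1 s a b y \<noteq> 0"
    using assms(2) unfolding layer_op_def by (metis (no_types, lifting) mult_zero_right sum.neutral)
  ultimately show ?thesis
    using tab_nonzero_bound[OF assms(1)] by (fastforce simp: NN_def)
qed

text \<open>Parametrization of the support of a tab by the choice of one point from each pair,
  together with a subset of the remaining points.\<close>

lemma sum_tab: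
  fixes a :: "nat \<Rightarrow> 'a::finite" and \<phi> :: "'a set \<Rightarrow> complex"
  assumes D: "disjoint_pairs s a b"
  defines "R \<equiv> - (a ` {..<s} \<union> b ` {..<s})"
  shows "(\<Sum>x\<in>{x. card x = r}. \<phi> x * tab r s a b x) =
    (\<Sum>E\<in>Pow {..<s}. \<Sum>z\<in>{z. z \<subseteq> R \<and> card z + s = r}.
       (-1) ^ card E * \<phi> (a ` E \<union> b ` ({..<s} - E) \<union> z))"
proof -
  let ?Z = "{z. z \<subseteq> R \<and> card z + s = r}"
  \<comment> \<open>E lists the pairs contributing their a-point; the other pairs contribute their
    b-point. \<open>j\<close> is the inverse on the support. Writing \<open>card z + s = r\<close>
    avoids truncated subtraction when r < s.\<close>
  define i where "i = (\<lambda>(E, z). a ` E \<union> b ` ({..<s} - E) \<union> z)"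
  define j where "j = (\<lambda>x. ({i. i < s \<and> a i \<in> x}, x \<inter> R))"
  note DD = disjoint_pairsD[OF D]
  have mem: "a k \<in> i (E, z) \<longleftrightarrow> k \<in> E" "b k \<in> i (E, z) \<longleftrightarrow> k \<notin> E" if "E \<subseteq> {..<s}" "z \<subseteq> R" "k < s" for E z k
    using that DD by (auto simp: i_def R_def)
  have card_i: "card (i (E, z)) = card z + s" if "E \<subseteq> {..<s}" "z \<subseteq> R" for E z
  proof -
    have "card (i (E, z)) = card (a ` E \<union> b ` ({..<s} - E)) + card z"
      unfolding i_def using that by (simp add: R_def) (subst card_Un_disjoint; auto)
    also have "card (a ` E \<union> b ` ({..<s} - E)) = card (a ` E) + card (b ` ({..<s} - E))"
      using that DD by (subst card_Un_disjoint) auto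
    also have "card (a ` E) = card E"
      using that D unfolding disjoint_pairs_def by (meson card_image inj_on_subset)
    also have "card (b ` ({..<s} - E)) = card ({..<s} - E)"
      using D unfolding disjoint_pairs_def by (meson card_image inj_on_subset Diff_subset)
    also have "card ({..<s} - E) = s - card E"
      using that by (simp add: card_Diff_subset finite_subset)
    finally show ?thesis using card_mono[of "{..<s}" E] that(1) by simp
  qed
  have tab_i: "tab r s a b (i (E, z)) = (-1) ^ card E" if "E \<subseteq> {..<s}" "z \<in> ?Z" for E z
  proof -
    have "{k. k < s \<and> a k \<in> i (E, z)} = E" using mem(1)[of E z] that by auto
    then show ?thesis
      using tab_separated[of s a "i (E, z)" b r] mem[of E z] card_i[of E z] that by (simp add: subset_iff)
  qed
  have ji: "j (i (E, z)) = (E, z)" if "E \<subseteq> {..<s}" "z \<subseteq> R" for E z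
  proof -
    have "{k. k < s \<and> a k \<in> i (E, z)} = E" using mem(1)[of E z] that by auto
    moreover have "i (E, z) \<inter> R = z" using that by (auto simp: i_def R_def)
    ultimately show ?thesis by (simp add: j_def)
  qed
  have ij: "i (j x) = x" if "tab r s a b x \<noteq> 0" for x
    using tab_nonzeroD(2)[OF that] by (auto simp: i_def j_def R_def)
  have jZ: "j x \<in> Pow {..<s} \<times> ?Z" if "tab r s a b x \<noteq> 0" for x
  proof -
    have "card (i (j x)) = card (x \<inter> R) + s" using card_i[of "fst (j x)" "snd (j x)"] by (auto simp: j_def)
    then show ?thesis using ij[OF that] tab_nonzeroD(1)[OF that] by (auto simp: j_def)
  qed
  have "(\<Sum>x\<in>{x. card x = r}. \<phi> x * tab r s a b x) = (\<Sum>x\<in>{x. tab r s a b x \<noteq> 0}. \<phi> x * tab r s a b x)"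
    by (rule sum.mono_neutral_right) (auto dest: tab_nonzeroD)
  also have "\<dots> = (\<Sum>p\<in>Pow {..<s} \<times> ?Z. (-1) ^ card (fst p) * \<phi> (i p))"
  proof (rule sum.reindex_bij_witness[where i = i and j = j])
    fix x assume "x \<in> {x. tab r s a b x \<noteq> 0}"
    then have x: "tab r s a b x \<noteq> 0" by simp
    show "i (j x) = x" "j x \<in> Pow {..<s} \<times> ?Z" using ij[OF x] jZ[OF x] by auto
    have "tab r s a b x = (-1) ^ card (fst (j x))"
      using tab_i[of "fst (j x)" "snd (j x)"] ij[OF x] jZ[OF x] by (auto simp: mem_Times_iff)
    then show "(-1) ^ card (fst (j x)) * \<phi> (i (j x)) = \<phi> x * tab r s a b x"
      using ij[OF x] by simp
  next
    fix p assume p: "p \<in> Pow {..<s} \<times> ?Z"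
    obtain E z where "p = (E, z)" by fastforce
    then show "j (i p) = p" "i p \<in> {x. tab r s a b x \<noteq> 0}" using p ji[of E z] tab_i[of E z] by auto
  qed
  also have "\<dots> = (\<Sum>E\<in>Pow {..<s}. \<Sum>z\<in>?Z. (-1) ^ card E * \<phi> (i (E, z)))"
    by (subst sum.cartesian_product) (simp add: case_prod_beta)
  finally show ?thesis by (simp add: i_def)
qed

text \<open>The scalar is the value at a set containing all b-points and no a-point;
  \<open>y\<close> is the rest of that set. Choosing the a-points of E removes exactly the b-points
  of E from x1 and so adds \<open>card E\<close> to the difference. \<open>R\<close> and
  \<open>y\<close> are independent of the kernel.\<close>

lemma layer_op_tab:
  fixes a :: "nat \<Rightarrow> 'a::finite"
  assumes D: "disjoint_pairs s a b" and le: "s \<le> r1" "s \<le> r2" "r2 + s \<le> card (UNIV :: 'a set)"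
  obtains R y :: "'a::finite set" where "card R = card (UNIV :: 'a set) - 2 * s" "y \<subseteq> R" "card y = r2 - s"
    "\<And>m. layer_op m r1 r2 (tab r1 s a b) = (\<lambda>x. (\<Sum>z\<in>{z. z \<subseteq> R \<and> card z = r1 - s}.
        \<Sum>E\<in>Pow {..<s}. (-1) ^ card E * m (card E + card (y - z))) * tab r2 s a b x)"
proof -
  obtain x0 where x0: "card x0 = r2" "b ` {..<s} \<subseteq> x0" "a ` {..<s} \<inter> x0 = {}"
    using reference_set_exists[OF D le(2,3)] by blast
  note C = disjoint_pairs_card[OF D]
  have bb: "b ` ({..<s} - E) = b ` {..<s} - b ` E" if "E \<subseteq> {..<s}" for E
    using D that unfolding disjoint_pairs_def by (simp add: inj_on_image_set_diff[of b "{..<s}"])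
  define R where "R = - (a ` {..<s} \<union> b ` {..<s})"
  define y where "y = x0 \<inter> R"
  have f1: "card R = card (UNIV :: 'a set) - 2 * s"
    using C by (simp add: R_def Compl_eq_Diff_UNIV card_Diff_subset)
  have f2: "y \<subseteq> R" by (simp add: y_def)
  have "y = x0 - b ` {..<s}" using x0 by (auto simp: y_def R_def)
  then have f3: "card y = r2 - s" using C x0 by (simp add: card_Diff_subset)
  have f4: "layer_op m r1 r2 (tab r1 s a b) = (\<lambda>x. (\<Sum>z\<in>{z. z \<subseteq> R \<and> card z = r1 - s}.
        \<Sum>E\<in>Pow {..<s}. (-1) ^ card E * m (card E + card (y - z))) * tab r2 s a b x)" for m
  proof -
    obtain c where c: "layer_op m r1 r2 (tab r1 s a b) = (\<lambda>x. c * tab r2 s a b x)"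
      using layer_op_tab_ex[OF D] by blast
    have card_diff: "card (x0 - (a ` E \<union> b ` ({..<s} - E) \<union> z)) = card E + card (y - z)"
      if "E \<subseteq> {..<s}" "z \<subseteq> R" for E z
    proof -
      have "x0 - (a ` E \<union> b ` ({..<s} - E) \<union> z) = b ` E \<union> (y - z)"
      proof -
        have "x0 - (AE \<union> (B - BE) \<union> z) = BE \<union> (x0 \<inter> R - z)"
          if "AE \<inter> x0 = {}" "BE \<subseteq> B" "B \<subseteq> x0" "B \<inter> R = {}" "x0 - B \<subseteq> R" "z \<subseteq> R" for AE B BE
          using that by auto
        moreover have "a ` E \<inter> x0 = {}" "b ` E \<subseteq> b ` {..<s}" using that(1) x0(3) by auto
        moreover have "b ` {..<s} \<inter> R = {}" "x0 - b ` {..<s} \<subseteq> R" using x0(3) by (auto simp: R_def)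
        ultimately show ?thesis using bb[OF that(1)] x0(2) that(2) unfolding y_def by metis
      qed
      moreover have "card (b ` E \<union> (y - z)) = card (b ` E) + card (y - z)"
        using that by (subst card_Un_disjoint) (auto simp: y_def R_def)
      moreover have "card (b ` E) = card E"
        using D that unfolding disjoint_pairs_def by (meson card_image inj_on_subset)
      ultimately show ?thesis by simp
    qed
    have "c = layer_op m r1 r2 (tab r1 s a b) x0" using tab_reference[OF x0] c by simp
    also have "\<dots> = (\<Sum>x\<in>{x. card x = r1}. m (card (x0 - x)) * tab r1 s a b x)"
      using x0 by (simp add: layer_op_def)
    also have "\<dots> = (\<Sum>E\<in>Pow {..<s}. \<Sum>z\<in>{z. z \<subseteq> R \<and> card z + s = r1}.
       (-1) ^ card E * m (card E + card (y - z)))"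
      unfolding sum_tab[OF D, of "\<lambda>x. m (card (x0 - x))"] R_def[symmetric]
      by (intro sum.cong) (auto simp: card_diff)
    also have "\<dots> = (\<Sum>z\<in>{z. z \<subseteq> R \<and> card z + s = r1}. \<Sum>E\<in>Pow {..<s}.
       (-1) ^ card E * m (card E + card (y - z)))"
      by (rule sum.swap)
    also have "{z. z \<subseteq> R \<and> card z + s = r1} = {z. z \<subseteq> R \<and> card z = r1 - s}" using le(1) by auto
    finally show ?thesis using c by simp
  qed
  show ?thesis by (rule that[OF f1 f2 f3 f4])
qed

subsection \<open>Eigenvalues of binomial and sign kernels\<close>

lemma sum_Pow_card:
  fixes F :: "nat \<Rightarrow> 'b::comm_ring_1"
  assumes "finite A"
  shows "(\<Sum>E\<in>Pow A. F (card E)) = (\<Sum>i\<le>card A. of_nat (card A choose i) * F i)"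
proof -
  have "(\<Sum>E\<in>Pow A. F (card E)) = (\<Sum>i\<le>card A. \<Sum>E\<in>{E\<in>Pow A. card E = i}. F (card E))"
    by (rule sum.group[symmetric]) (use assms in \<open>auto intro: card_mono\<close>)
  also have "\<dots> = (\<Sum>i\<le>card A. of_nat (card A choose i) * F i)"
  proof (rule sum.cong)
    fix i
    have "(\<Sum>E\<in>{E\<in>Pow A. card E = i}. F (card E)) = (\<Sum>E\<in>{E\<in>Pow A. card E = i}. F i)"
      by (rule sum.cong) auto
    then show "(\<Sum>E\<in>{E\<in>Pow A. card E = i}. F (card E)) = of_nat (card A choose i) * F i"
      using n_subsets[OF assms, of i] by simp
  qed simp
  finally show ?thesis .
qed

text \<open>Up to sign a t-th finite difference of a binomial: by Pascal's rule each difference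
  lowers the lower index by one, until nothing remains when t > j.\<close>

lemma alternating_sum_choose:
  "(\<Sum>i\<le>t. of_nat (t choose i) * ((-1) ^ i * of_nat ((i + l) choose j)) :: 'b::comm_ring_1) =
     (if t \<le> j then (-1) ^ t * of_nat (l choose (j - t)) else 0)"
proof (induction t arbitrary: j)
  case 0
  then show ?case by simp
next
  case (Suc t)
  let ?F = "\<lambda>j i. (-1) ^ i * of_nat ((i + l) choose j) :: 'b"
  have "(\<Sum>i\<le>Suc t. of_nat (Suc t choose i) * ?F j i) =
      ?F j 0 + (\<Sum>i\<le>t. of_nat (Suc t choose Suc i) * ?F j (Suc i))"
    by (subst sum.atMost_Suc_shift) simp
  also have "(\<Sum>i\<le>t. of_nat (Suc t choose Suc i) * ?F j (Suc i)) =
      (\<Sum>i\<le>t. of_nat (t choose i) * ?F j (Suc i)) + (\<Sum>i\<le>t. of_nat (t choose Suc i) * ?F j (Suc i))"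
    by (simp add: sum.distrib[symmetric] algebra_simps del: power_Suc add_Suc)
  also have "?F j 0 + ((\<Sum>i\<le>t. of_nat (t choose i) * ?F j (Suc i)) + (\<Sum>i\<le>t. of_nat (t choose Suc i) * ?F j (Suc i)))
      = (\<Sum>i\<le>t. of_nat (t choose i) * ?F j (Suc i)) + (\<Sum>i\<le>Suc t. of_nat (t choose i) * ?F j i)"
    by (subst sum.atMost_Suc_shift[of "\<lambda>i. of_nat (t choose i) * ?F j i"]) simp
  also have "(\<Sum>i\<le>Suc t. of_nat (t choose i) * ?F j i) = (\<Sum>i\<le>t. of_nat (t choose i) * ?F j i)"
    by (simp add: binomial_eq_0)
  also have "(\<Sum>i\<le>t. of_nat (t choose i) * ?F j (Suc i)) + (\<Sum>i\<le>t. of_nat (t choose i) * ?F j i) =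
     (\<Sum>i\<le>t. of_nat (t choose i) * (?F j (Suc i) + ?F j i))"
    by (simp add: sum.distrib[symmetric] algebra_simps del: power_Suc add_Suc)
  also have "\<dots> = (if Suc t \<le> j then (-1) ^ Suc t * of_nat (l choose (j - Suc t)) else 0)"
  proof (cases j)
    case 0
    then show ?thesis by simp
  next
    case (Suc k)
    \<comment> \<open>The alternating sign turns this sum into a difference, to which Pascal's rule
      applies.\<close>
    then have "?F j (Suc i) + ?F j i = - ?F k i" for i by (simp add: algebra_simps)
    then show ?thesis using Suc.IH[of k] Suc by (simp add: sum_negf)
  qed
  finally show ?case .
qed

text \<open>Double counting of pairs (z, c), where c is an i-subset of \<open>y\<close> disjoint
  from z.\<close>

lemma sum_subsets_choose_diff:
  fixes R y :: "'a set"
  assumes "finite R" "y \<subseteq> R"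
  shows "(\<Sum>z\<in>{z. z \<subseteq> R \<and> card z = m}. card (y - z) choose i) = (card y choose i) * ((card R - i) choose m)"
proof -
  let ?Z = "{z. z \<subseteq> R \<and> card z = m}" and ?C = "{c. c \<subseteq> y \<and> card c = i}"
  have fy: "finite y" using assms finite_subset by blast
  have "(\<Sum>z\<in>?Z. card (y - z) choose i) = (\<Sum>z\<in>?Z. \<Sum>c\<in>?C. of_bool (c \<inter> z = {}))"
  proof (rule sum.cong)
    fix z
    have "card (y - z) choose i = card {c. c \<subseteq> y - z \<and> card c = i}"
      using n_subsets[of "y - z" i] fy by simp
    also have "{c. c \<subseteq> y - z \<and> card c = i} = {c\<in>?C. c \<inter> z = {}}" by auto
    also have "card \<dots> = (\<Sum>c\<in>?C. of_bool (c \<inter> z = {}))"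
      using fy by (simp add: of_bool_def sum.If_cases Int_def)
    finally show "card (y - z) choose i = (\<Sum>c\<in>?C. of_bool (c \<inter> z = {}))" .
  qed simp
  also have "\<dots> = (\<Sum>c\<in>?C. \<Sum>z\<in>?Z. of_bool (c \<inter> z = {}))" by (rule sum.swap)
  also have "\<dots> = (\<Sum>c\<in>?C. (card R - i) choose m)"
  proof (rule sum.cong)
    fix c assume c: "c \<in> ?C"
    have "(\<Sum>z\<in>?Z. of_bool (c \<inter> z = {})) = card {z\<in>?Z. c \<inter> z = {}}"
      using assms by (simp add: of_bool_def sum.If_cases Int_def)
    also have "{z\<in>?Z. c \<inter> z = {}} = {z. z \<subseteq> R - c \<and> card z = m}" by auto
    also have "card \<dots> = card (R - c) choose m" using n_subsets[of "R - c" m] assms by simp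
    also have "card (R - c) = card R - i"
      using c assms fy by (subst card_Diff_subset) (auto intro: finite_subset)
    finally show "(\<Sum>z\<in>?Z. of_bool (c \<inter> z = {})) = (card R - i) choose m" .
  qed simp
  also have "\<dots> = (card y choose i) * ((card R - i) choose m)" using n_subsets[OF fy, of i] by simp
  finally show ?thesis .
qed

text \<open>Grouping by j = |y \<inter> z|, a set z amounts to a j-subset of \<open>y\<close> and an
  (m - j)-subset of \<open>R - y\<close>; the signed count is the Krawtchouk sum.\<close>

lemma sum_subsets_sign:
  fixes R y :: "'a set"
  assumes "finite R" "y \<subseteq> R"
  shows "(\<Sum>z\<in>{z. z \<subseteq> R \<and> card z = m}. (-1) ^ card (y \<inter> z)) = krawtchouk m (card y) (card R)"
proof -
  let ?Z = "{z. z \<subseteq> R \<and> card z = m}"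
  have fy: "finite y" using assms finite_subset by blast
  have fZ: "finite ?Z" using assms by simp
  have le: "card (y \<inter> z) \<le> m" if "z \<in> ?Z" for z
    using that assms(1) card_mono[of z "y \<inter> z"] finite_subset by auto
  have cnt: "card {z\<in>?Z. card (y \<inter> z) = j} = (card y choose j) * ((card R - card y) choose (m - j))"
    if "j \<le> m" for j
  proof -
    let ?P = "{p. p \<subseteq> y \<and> card p = j}" and ?Q = "{q. q \<subseteq> R - y \<and> card q = m - j}"
    have "bij_betw (\<lambda>z. (z \<inter> y, z - y)) {z\<in>?Z. card (y \<inter> z) = j} (?P \<times> ?Q)"
    proof (rule bij_betw_byWitness[where f' = "\<lambda>(p, q). p \<union> q"])
      show "(\<lambda>z. (z \<inter> y, z - y)) ` {z\<in>?Z. card (y \<inter> z) = j} \<subseteq> ?P \<times> ?Q"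
      proof
        fix w assume "w \<in> (\<lambda>z. (z \<inter> y, z - y)) ` {z\<in>?Z. card (y \<inter> z) = j}"
        then obtain z where z: "w = (z \<inter> y, z - y)" "z \<subseteq> R" "card z = m" "card (y \<inter> z) = j" by auto
        then have "card (z - y) = m - j"
          using card_Diff_subset_Int[of z y] fy by (simp add: Int_commute)
        then show "w \<in> ?P \<times> ?Q" using z by (auto simp: Int_commute)
      qed
      show "(\<lambda>(p, q). p \<union> q) ` (?P \<times> ?Q) \<subseteq> {z\<in>?Z. card (y \<inter> z) = j}"
      proof
        fix z assume "z \<in> (\<lambda>(p, q). p \<union> q) ` (?P \<times> ?Q)"
        then obtain p q where pq: "z = p \<union> q" "p \<subseteq> y" "card p = j" "q \<subseteq> R - y" "card q = m - j" by auto
        have "card z = card p + card q"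
          unfolding pq(1) using pq assms fy by (intro card_Un_disjoint) (auto intro: finite_subset)
        moreover have "y \<inter> z = p" using pq by auto
        ultimately show "z \<in> {z\<in>?Z. card (y \<inter> z) = j}" using pq assms that by auto
      qed
    qed (auto simp: subset_iff)
    then have "card {z\<in>?Z. card (y \<inter> z) = j} = card ?P * card ?Q"
      by (simp only: bij_betw_same_card card_cartesian_product)
    also have "card ?P = card y choose j" using n_subsets[OF fy] .
    also have "card ?Q = card (R - y) choose (m - j)" using n_subsets[of "R - y"] assms by simp
    also have "card (R - y) = card R - card y" using assms fy by (simp add: card_Diff_subset)
    finally show ?thesis .
  qed
  have "(\<Sum>z\<in>?Z. (-1) ^ card (y \<inter> z) :: real) = (\<Sum>j=0..m. \<Sum>z\<in>{z\<in>?Z. card (y \<inter> z) = j}. (-1) ^ card (y \<inter> z))"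
    by (rule sum.group[symmetric]) (use fZ le in auto)
  also have "\<dots> = (\<Sum>j=0..m. (-1) ^ j * real (card {z\<in>?Z. card (y \<inter> z) = j}))"
  proof (rule sum.cong)
    fix j
    have "(\<Sum>z\<in>{z\<in>?Z. card (y \<inter> z) = j}. (-1) ^ card (y \<inter> z) :: real) = (\<Sum>z\<in>{z\<in>?Z. card (y \<inter> z) = j}. (-1) ^ j)"
      by (rule sum.cong) auto
    then show "(\<Sum>z\<in>{z\<in>?Z. card (y \<inter> z) = j}. (-1) ^ card (y \<inter> z) :: real) = (-1) ^ j * real (card {z\<in>?Z. card (y \<inter> z) = j})"
      by simp
  qed simp
  also have "\<dots> = krawtchouk m (card y) (card R)"
    unfolding krawtchouk_def by (rule sum.cong[OF refl]) (simp only: atLeastAtMost_iff cnt of_nat_mult mult.assoc)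
  finally show ?thesis .
qed

text \<open>The inner sum over E is a t-th difference, which lowers j to j - t; the outer sum is the
  double count over z.\<close>

lemma layer_op_choose_tab:
  fixes a :: "nat \<Rightarrow> 'a::finite"
  assumes D: "disjoint_pairs t a b" and le: "t \<le> r1" "t \<le> r2" "r2 + t \<le> card (UNIV :: 'a set)"
  shows "layer_op (\<lambda>k. of_nat (k choose j)) r1 r2 (tab r1 t a b) = (\<lambda>x. (if t \<le> j then
    (-1) ^ t * of_nat (((r2 - t) choose (j - t)) * ((card (UNIV :: 'a set) - t - j) choose (r1 - t))) else 0) * tab r2 t a b x)"
proof -
  let ?n = "card (UNIV :: 'a set)"
  obtain R y :: "'a set" where R: "card R = ?n - 2 * t" "y \<subseteq> R" "card y = r2 - t"
    and op: "\<And>m. layer_op m r1 r2 (tab r1 t a b) = (\<lambda>x. (\<Sum>z\<in>{z. z \<subseteq> R \<and> card z = r1 - t}.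
        \<Sum>E\<in>Pow {..<t}. (-1) ^ card E * m (card E + card (y - z))) * tab r2 t a b x)"
    by (rule layer_op_tab[OF assms]) blast
  have "(\<Sum>E\<in>Pow {..<t}. (-1) ^ card E * of_nat ((card E + l) choose j) :: complex) =
      (if t \<le> j then (-1) ^ t * of_nat (l choose (j - t)) else 0)" for l
    using sum_Pow_card[of "{..<t}" "\<lambda>e. (-1) ^ e * of_nat ((e + l) choose j) :: complex"]
      alternating_sum_choose[of t l j, where 'b = complex] by simp
  then have "(\<Sum>z\<in>{z. z \<subseteq> R \<and> card z = r1 - t}.
        \<Sum>E\<in>Pow {..<t}. (-1) ^ card E * of_nat ((card E + card (y - z)) choose j) :: complex) =
      (if t \<le> j then (-1) ^ t * of_nat (\<Sum>z\<in>{z. z \<subseteq> R \<and> card z = r1 - t}. card (y - z) choose (j - t)) else 0)"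
    by (simp add: sum_distrib_left)
  also have "\<dots> = (if t \<le> j then (-1) ^ t * of_nat (((r2 - t) choose (j - t)) * ((?n - t - j) choose (r1 - t))) else 0)"
  proof (cases "t \<le> j")
    case True
    then have "?n - 2 * t - (j - t) = ?n - t - j" by simp
    then show ?thesis by (simp only: sum_subsets_choose_diff[OF finite R(2)] R)
  qed simp
  finally show ?thesis unfolding op by simp
qed

text \<open>The two signs depending on \<open>card E\<close> cancel, so the sum over E gives 2^t.
  The remaining sign is (-1)^t times (-1)^|y \<inter> z|, and summation over z gives the Krawtchouk
  value.\<close>

lemma layer_op_sign_tab:
  fixes a :: "nat \<Rightarrow> 'a::finite"
  assumes D: "disjoint_pairs t a b" and le: "t \<le> r1" "t \<le> r2" "r2 + t \<le> card (UNIV :: 'a set)"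
  shows "layer_op (\<lambda>k. (-1) ^ (r2 + k)) r1 r2 (tab r1 t a b) =
    (\<lambda>x. of_real ((-2) ^ t * krawtchouk (r1 - t) (r2 - t) (card (UNIV :: 'a set) - 2 * t)) * tab r2 t a b x)"
proof -
  let ?n = "card (UNIV :: 'a set)"
  obtain R y :: "'a set" where R: "card R = ?n - 2 * t" "y \<subseteq> R" "card y = r2 - t"
    and op: "\<And>m. layer_op m r1 r2 (tab r1 t a b) = (\<lambda>x. (\<Sum>z\<in>{z. z \<subseteq> R \<and> card z = r1 - t}.
        \<Sum>E\<in>Pow {..<t}. (-1) ^ card E * m (card E + card (y - z))) * tab r2 t a b x)"
    by (rule layer_op_tab[OF assms]) blast
  have "(\<Sum>E\<in>Pow {..<t}. (-1) ^ card E * (-1) ^ (r2 + (card E + card (y - z)))) =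
      (-2) ^ t * complex_of_real ((-1) ^ card (y \<inter> z))" for z
  proof -
    have "card (y - z) + card (y \<inter> z) = r2 - t"
      using R(3) card_Int_Diff[of y z] by simp
    \<comment> \<open>The even summand makes the parity comparison free of subtraction of
      \<open>card (y \<inter> z)\<close>.\<close>
    then have s: "r2 + card (y - z) + 2 * card (y \<inter> z) = 2 * (r2 - t) + t + card (y \<inter> z)" using le(2) by simp
    have "(-1) ^ (r2 + card (y - z)) = (-1 :: complex) ^ (r2 + card (y - z) + 2 * card (y \<inter> z))"
      by (simp add: power_add power_mult)
    also have "\<dots> = (-1) ^ t * (-1) ^ card (y \<inter> z)" unfolding s by (simp add: power_add power_mult)
    finally have s': "(-1) ^ (r2 + card (y - z)) = (-1 :: complex) ^ t * (-1) ^ card (y \<inter> z)" .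
    have "(-1) ^ card E * (-1) ^ (r2 + (card E + card (y - z))) = (-1 :: complex) ^ (r2 + card (y - z))" for E :: "nat set"
      by (simp add: power_add)
    then have "(\<Sum>E\<in>Pow {..<t}. (-1) ^ card E * (-1) ^ (r2 + (card E + card (y - z)))) =
        2 ^ t * (-1 :: complex) ^ (r2 + card (y - z))"
      by (simp add: card_Pow)
    also have "\<dots> = (2 ^ t * (-1) ^ t) * (-1) ^ card (y \<inter> z)" unfolding s' by simp
    also have "2 ^ t * (-1) ^ t = (-2 :: complex) ^ t" by (simp flip: power_mult_distrib)
    finally show ?thesis by simp
  qed
  then have "(\<Sum>z\<in>{z. z \<subseteq> R \<and> card z = r1 - t}.
        \<Sum>E\<in>Pow {..<t}. (-1) ^ card E * (-1) ^ (r2 + (card E + card (y - z)))) =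
      (-2) ^ t * complex_of_real (\<Sum>z\<in>{z. z \<subseteq> R \<and> card z = r1 - t}. (-1) ^ card (y \<inter> z))"
    by (simp only: sum_distrib_left of_real_sum)
  also have "\<dots> = of_real ((-2) ^ t * krawtchouk (r1 - t) (r2 - t) (?n - 2 * t))"
    unfolding sum_subsets_sign[OF finite R(2)] R by simp
  finally show ?thesis unfolding op by simp
qed

subsection \<open>Hahn polynomials\<close>

text \<open>A basis adapted to the operators: at a natural number k the value is j! times k choose
  j, and binomial kernels have explicit scalars on tabs.\<close>

definition falling_poly :: "nat \<Rightarrow> complex poly" where
  "falling_poly j = (\<Prod>i<j. [:- of_nat i, 1:])"

text \<open>The terminating series 3F2(-s, -k, s-n-1; -r2, r1-n; 1), expanded in falling factorials of k.\<close>

definition hahn_coeff :: "nat \<Rightarrow> nat \<Rightarrow> nat \<Rightarrow> nat \<Rightarrow> nat \<Rightarrow> real" where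
  "hahn_coeff n r1 r2 s j = (-1) ^ j * real (s choose j) * ffac (real (n - s + 1)) j /
     (ffac (real r2) j * ffac (real (n - r1)) j)"

definition hahn :: "nat \<Rightarrow> nat \<Rightarrow> nat \<Rightarrow> nat \<Rightarrow> complex poly" where
  "hahn n r1 r2 s = (\<Sum>j\<le>s. smult (of_real (hahn_coeff n r1 r2 s j)) (falling_poly j))"

text \<open>The scalar of the Hahn kernel on tabs with s pairs, to which only the term j = s
  contributes.\<close>

definition hahn_eigenvalue :: "nat \<Rightarrow> nat \<Rightarrow> nat \<Rightarrow> nat \<Rightarrow> real" where
  "hahn_eigenvalue n r1 r2 s = real ((n - 2 * s) choose (r1 - s)) * fact s * ffac (real (n - s + 1)) s /
     (ffac (real r2) s * ffac (real (n - r1)) s)"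

lemma ffac_fact:
  assumes "j \<le> m"
  shows "ffac (real m) j = fact m / fact (m - j)"
  using assms
proof (induction j)
  case (Suc j)
  have "m - j = Suc (m - Suc j)" using Suc.prems by simp
  then have "fact (m - j) = (real m - real j) * fact (m - Suc j)"
    using Suc.prems by (simp add: fact_Suc of_nat_diff)
  then have "fact m / fact (m - j) * (real m - real j) = fact m / fact (m - Suc j)"
    using Suc.prems by simp
  then show ?case using Suc by (simp add: ffac_def)
qed (simp add: ffac_def)

lemma ffac_pos: "j \<le> m \<Longrightarrow> ffac (real m) j > 0"
  by (simp add: ffac_fact)

lemma poly_falling_poly: "poly (falling_poly j) (of_nat k) = fact j * of_nat (k choose j)"
proof -
  have "of_nat (k choose j) = (of_nat k gchoose j :: complex)" by (rule binomial_gbinomial)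
  then show ?thesis
    by (simp add: falling_poly_def poly_prod gbinomial_prod_rev lessThan_atLeast0)
qed

lemma degree_falling_poly: "degree (falling_poly j) = j"
  unfolding falling_poly_def by (subst degree_prod_eq_sum_degree) auto

lemma lead_coeff_falling_poly: "coeff (falling_poly j) j = 1"
proof -
  have "lead_coeff (falling_poly j) = 1"
    unfolding falling_poly_def by (simp add: lead_coeff_prod)
  then show ?thesis by (simp add: degree_falling_poly)
qed

lemma poly_falling_poly_0: "poly (falling_poly j) 0 = of_bool (j = 0)"
  by (auto simp: falling_poly_def poly_prod)

lemma poly_hahn:
  "poly (hahn n r1 r2 s) (of_nat k) =
     (\<Sum>j\<le>s. of_real (hahn_coeff n r1 r2 s j * fact j) * of_nat (k choose j))"
  by (simp add: hahn_def poly_sum poly_falling_poly mult.assoc)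

lemma poly_hahn_0: "poly (hahn n r1 r2 s) 0 = 1"
proof -
  have "poly (hahn n r1 r2 s) 0 = (\<Sum>j\<le>s. of_real (hahn_coeff n r1 r2 s j) * of_bool (j = 0))"
    by (simp add: hahn_def poly_sum poly_falling_poly_0)
  also have "\<dots> = of_real (hahn_coeff n r1 r2 s 0)" by (simp add: of_bool_def if_distrib sum.If_cases cong: if_cong)
  finally show ?thesis by (simp add: hahn_coeff_def ffac_def)
qed

text \<open>The coefficient at s comes from the term j = s alone. The bound on s keeps its falling
  factorials positive, in particular its denominator away from 0, where division would return
  0.\<close>

lemma degree_hahn:
  assumes "s \<le> NN n r1 r2"
  shows "degree (hahn n r1 r2 s) = s"
proof (rule antisym)
  show "degree (hahn n r1 r2 s) \<le> s"
    unfolding hahn_def by (rule degree_sum_le) (auto intro: order_trans[OF degree_smult_le] simp: degree_falling_poly)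
  have "coeff (hahn n r1 r2 s) s = (\<Sum>j\<le>s. of_real (hahn_coeff n r1 r2 s j) * coeff (falling_poly j) s)"
    by (simp add: hahn_def coeff_sum)
  also have "\<dots> = (\<Sum>j\<in>{s}. of_real (hahn_coeff n r1 r2 s j) * coeff (falling_poly j) s)"
    by (rule sum.mono_neutral_right) (auto simp: coeff_eq_0 degree_falling_poly)
  also have "\<dots> = of_real (hahn_coeff n r1 r2 s s)" by (simp add: lead_coeff_falling_poly)
  also have "\<dots> \<noteq> 0"
  proof -
    have "s \<le> n - s + 1" "s \<le> r2" "s \<le> n - r1" using assms by (auto simp: NN_def)
    then show ?thesis
      using ffac_pos[of s "n - s + 1"] ffac_pos[of s r2] ffac_pos[of s "n - r1"] by (simp add: hahn_coeff_def)
  qed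
  finally show "s \<le> degree (hahn n r1 r2 s)" by (rule le_degree)
qed

lemma hahn_eigenvalue_pos:
  assumes "s \<le> NN n r1 r2" "r1 \<le> n" "r2 \<le> n"
  shows "hahn_eigenvalue n r1 r2 s > 0"
proof -
  have "s \<le> n - s + 1" "s \<le> r2" "s \<le> n - r1" "r1 - s \<le> n - 2 * s" using assms by (auto simp: NN_def)
  then show ?thesis
    using ffac_pos[of s "n - s + 1"] ffac_pos[of s r2] ffac_pos[of s "n - r1"] by (simp add: hahn_eigenvalue_def)
qed

text \<open>The algebra of \<open>hahn_sum\<close> with nonzero variables in place of factorials and
  signs, so that simplification treats them as atoms.\<close>

lemma hahn_term_rearrange:
  fixes S :: real
  assumes sign: "ej * et = eu * ei" and nz: "S \<noteq> 0" "J \<noteq> 0" "I \<noteq> 0" "M \<noteq> 0" "M' \<noteq> 0" "R \<noteq> 0" "Rj \<noteq> 0"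
    "P \<noteq> 0" "Pj \<noteq> 0" "Q \<noteq> 0" "UI \<noteq> 0" "L \<noteq> 0" "Rt \<noteq> 0" "U \<noteq> 0" "U1 \<noteq> 0"
  shows "ej * (S / (J * I)) * (M / M') / ((R / Rj) * (P / Pj)) * J * (et * ((Q / (UI * Rj)) * (L / (Rt * Pj)))) =
    S * M * Q / (R * Rt * P) * (U1 / U) * eu * ((U / (I * UI)) * (ei * (L / (U1 * M'))))"
proof -
  have "ej * (S / (J * I)) * (M / M') / ((R / Rj) * (P / Pj)) * J * (et * ((Q / (UI * Rj)) * (L / (Rt * Pj)))) =
      (ej * et) * (S * M * Q * L / (I * M' * R * P * UI * Rt))"
    using nz by (simp add: field_simps)
  also have "\<dots> = S * M * Q / (R * Rt * P) * (U1 / U) * eu * ((U / (I * UI)) * (ei * (L / (U1 * M'))))"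
    unfolding sign using nz by (simp add: field_simps)
  finally show ?thesis .
qed

text \<open>For \<open>t < s\<close> the sum is a finite difference of order \<open>s - t\<close> of a polynomial
  of degree \<open>s - t - 1\<close>.\<close>

lemma hahn_sum:
  assumes s: "s \<le> NN n r1 r2" and t: "t \<le> NN n r1 r2" and r: "r1 \<le> n" "r2 \<le> n"
  shows "(\<Sum>j\<le>s. hahn_coeff n r1 r2 s j * fact j *
      (if t \<le> j then (-1) ^ t * real (((r2 - t) choose (j - t)) * ((n - t - j) choose (r1 - t))) else 0)) =
    (if t = s then hahn_eigenvalue n r1 r2 s else 0)"
    (is "(\<Sum>j\<le>s. ?T j) = _")
proof -
  have b: "s \<le> r1" "s \<le> n - r1" "s \<le> r2" "s \<le> n - r2" "t \<le> r1" "t \<le> n - r1" "t \<le> r2" "t \<le> n - r2"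
    using s t by (auto simp: NN_def)
  have "2 * s \<le> n" using b(1,2) r by linarith
  consider "t > s" | "t = s" | "t < s" by linarith
  then show ?thesis
  proof cases
    case 1
    then show ?thesis by (auto intro!: sum.neutral)
  next
    case 2
    have "(\<Sum>j\<le>s. ?T j) = (\<Sum>j\<in>{s}. ?T j)"
      by (rule sum.mono_neutral_right) (use 2 in auto)
    also have "\<dots> = ((-1) ^ s * (-1) ^ s) * hahn_eigenvalue n r1 r2 s"
      using 2 by (simp add: hahn_coeff_def hahn_eigenvalue_def mult_2)
    also have "(-1) ^ s * (-1) ^ s = (1 :: real)" by (simp flip: power_mult_distrib)
    finally show ?thesis using 2 by simp
  next
    case 3
    define u where "u = s - t"
    define l where "l = n - t - s"
    \<comment> \<open>\<open>K\<close> collects the factors independent of i after the reversal j =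
      s - i. The quotient of (u - 1)! and u! appears when the remaining factorials are completed to
      the binomials u choose i and i + l choose u - 1.\<close>
    define K :: real where "K = fact s * fact (n - s + 1) * fact (r2 - t) /
      (fact r2 * fact (r1 - t) * fact (n - r1)) * (fact (u - 1) / fact u) * (-1) ^ u"
    have T: "?T (s - i) = K * (real (u choose i) * ((-1) ^ i * real ((i + l) choose (u - 1))))"
      if i: "i \<le> u" for i
    proof -
      define j where "j = s - i"
      have j: "t \<le> j" "j \<le> s" "j \<le> r2" "j \<le> n - r1" "j \<le> n - s + 1" using i b 3 by (auto simp: j_def u_def)
      have ji: "j - t = u - i" "s - j = i" "n - t - j = i + l" using i b 3 r by (auto simp: j_def u_def l_def)
      have h1: "hahn_coeff n r1 r2 s j * fact j = (-1) ^ j * (fact s / (fact j * fact i)) * (fact (n - s + 1) / fact (n - s + 1 - j)) /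
          ((fact r2 / fact (r2 - j)) * (fact (n - r1) / fact (n - r1 - j))) * fact j"
        unfolding hahn_coeff_def ffac_fact[OF j(3)] ffac_fact[OF j(4)] ffac_fact[OF j(5)]
          binomial_fact[OF j(2)] ji(2) ..
      have h2: "real ((r2 - t) choose (j - t)) = fact (r2 - t) / (fact (u - i) * fact (r2 - j))"
      proof -
        have "r2 - t - (u - i) = r2 - j" "u - i \<le> r2 - t" using j ji(1) by linarith+
        then show ?thesis by (simp add: ji(1) binomial_fact)
      qed
      have h3: "real ((n - t - j) choose (r1 - t)) = fact (i + l) / (fact (r1 - t) * fact (n - r1 - j))"
      proof -
        have "i + l - (r1 - t) = n - r1 - j" "r1 - t \<le> i + l" using j b r ji(3) by linarith+
        then show ?thesis unfolding ji(3) by (simp add: binomial_fact)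
      qed
      have h4: "real (u choose i) = fact u / (fact i * fact (u - i))" using i by (simp add: binomial_fact)
      have h5: "real ((i + l) choose (u - 1)) = fact (i + l) / (fact (u - 1) * fact (n - s + 1 - j))"
      proof -
        have "i + l - (u - 1) = n - s + 1 - j" "u - 1 \<le> i + l"
          using i 3 \<open>2 * s \<le> n\<close> unfolding j_def u_def l_def by linarith+
        then show ?thesis by (simp add: binomial_fact)
      qed
      have h6: "(-1) ^ j * (-1) ^ t = (-1 :: real) ^ u * (-1) ^ i"
      proof -
        \<comment> \<open>Even summands replace subtraction in the comparison of parities.\<close>
        have "j + t + 2 * i = u + i + 2 * t" using i 3 by (auto simp: j_def u_def)
        then have "(-1 :: real) ^ (j + t + 2 * i) = (-1) ^ (u + i + 2 * t)" by (simp only:)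
        then show ?thesis by (simp add: power_add power_mult)
      qed
      have "?T (s - i) = (hahn_coeff n r1 r2 s j * fact j) *
          ((-1) ^ t * (real ((r2 - t) choose (j - t)) * real ((n - t - j) choose (r1 - t))))"
        unfolding j_def[symmetric] using j(1) by simp
      then show ?thesis
        unfolding h1 h2 h3 h4 h5 K_def
        by (simp only: hahn_term_rearrange[OF h6] fact_nonzero not_False_eq_True)
    qed
    have "(\<Sum>j\<le>s. ?T j) = (\<Sum>j=t..s. ?T j)"
      by (rule sum.mono_neutral_right) auto
    also have "\<dots> = (\<Sum>i\<le>u. ?T (s - i))"
      by (rule sum.reindex_bij_witness[where i = "\<lambda>i. s - i" and j = "\<lambda>j. s - j"]) (use 3 in \<open>auto simp: u_def\<close>)
    also have "\<dots> = (\<Sum>i\<le>u. K * (real (u choose i) * ((-1) ^ i * real ((i + l) choose (u - 1)))))"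
      by (rule sum.cong) (use T in auto)
    also have "\<dots> = K * (\<Sum>i\<le>u. real (u choose i) * ((-1) ^ i * real ((i + l) choose (u - 1))))"
      by (rule sum_distrib_left[symmetric])
    also have "(\<Sum>i\<le>u. real (u choose i) * ((-1) ^ i * real ((i + l) choose (u - 1)))) = 0"
      using alternating_sum_choose[of u l "u - 1", where 'b = real] 3 by (simp add: u_def)
    finally show ?thesis using 3 by simp
  qed
qed

section \<open>Operators with Hahn kernel\<close>

lemma layer_op_kernel_sum:
  "layer_op (\<lambda>k. \<Sum>j\<in>J. c j * m j k) r1 r2 f x = (\<Sum>j\<in>J. c j * layer_op (m j) r1 r2 f x)"
proof (cases "card x = r2")
  case True
  then have "layer_op (\<lambda>k. \<Sum>j\<in>J. c j * m j k) r1 r2 f x =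
      (\<Sum>x1\<in>{x. card x = r1}. \<Sum>j\<in>J. c j * (m j (card (x - x1)) * f x1))"
    by (simp add: layer_op_def sum_distrib_right mult.assoc)
  also have "\<dots> = (\<Sum>j\<in>J. \<Sum>x1\<in>{x. card x = r1}. c j * (m j (card (x - x1)) * f x1))"
    by (rule sum.swap)
  finally show ?thesis using True by (simp add: layer_op_def sum_distrib_left)
qed (simp add: layer_op_def)

text \<open>The explicit candidate for \<open>Lambda r1 r2 s\<close>; the identification is
  \<open>Lambda_eq_hahn_op\<close>.\<close>

definition hahn_op :: "nat \<Rightarrow> nat \<Rightarrow> nat \<Rightarrow> 'a::finite L2 \<Rightarrow> 'a L2" where
  "hahn_op r1 r2 s = layer_op (\<lambda>k. poly (hahn (card (UNIV :: 'a set)) r1 r2 s) (of_nat k)) r1 r2"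

text \<open>Expanding the kernel in binomials reduces the scalar to \<open>hahn_sum\<close>. The
  operator thus singles out tabs with exactly s pairs.\<close>

lemma hahn_op_tab:
  fixes a :: "nat \<Rightarrow> 'a::finite"
  defines "n \<equiv> card (UNIV :: 'a set)"
  assumes D: "disjoint_pairs t a b" and s: "s \<le> NN n r1 r2" and r: "r1 \<le> n" "r2 \<le> n"
  shows "hahn_op r1 r2 s (tab r1 t a b) =
    (\<lambda>x. (if t = s then of_real (hahn_eigenvalue n r1 r2 s) else 0) * tab r2 t a b x)"
proof (cases "t \<le> NN n r1 r2")
  case False
  then have "hahn_op r1 r2 s (tab r1 t a b) x = 0" for x
    using layer_op_tab_nonzero_bound[OF D] unfolding hahn_op_def n_def by blast
  then show ?thesis using False s by auto
next
  case True
  then have t: "t \<le> r1" "t \<le> r2" "r2 + t \<le> card (UNIV :: 'a set)"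
    using r by (auto simp: NN_def n_def)
  let ?c = "\<lambda>j. hahn_coeff n r1 r2 s j * fact j"
  let ?d = "\<lambda>j. if t \<le> j then (-1) ^ t * real (((r2 - t) choose (j - t)) * ((n - t - j) choose (r1 - t))) else 0"
  have op: "layer_op (\<lambda>k. of_nat (k choose j)) r1 r2 (tab r1 t a b) x = of_real (?d j) * tab r2 t a b x" for j x
    unfolding layer_op_choose_tab[OF D t] n_def by simp
  have "hahn_op r1 r2 s (tab r1 t a b) x = of_real (\<Sum>j\<le>s. ?c j * ?d j) * tab r2 t a b x" for x
    unfolding hahn_op_def poly_hahn layer_op_kernel_sum op n_def[symmetric]
    by (simp only: of_real_sum of_real_mult sum_distrib_right mult.assoc)
  then show ?thesis unfolding hahn_sum[OF s True r] by auto
qed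

subsection \<open>The irreducible components\<close>

text \<open>The copy of the Specht module on level r, written as an intersection of subspaces to
  match \<open>specht\<close>.\<close>

definition tab_span :: "nat \<Rightarrow> nat \<Rightarrow> 'a L2 set" where
  "tab_span r s = \<Inter>{W. csubsp W \<and> {tab r s a b | a b. disjoint_pairs s a b} \<subseteq> W}"

lemma csubsp_zero: "csubsp W \<Longrightarrow> (\<lambda>x. 0) \<in> W"
  by (simp add: csubsp_def)

lemma csubsp_tab_span: "csubsp (tab_span r s)"
  unfolding csubsp_def tab_span_def
  by (auto intro: csubsp_zero csubsp_add csubsp_scale)

lemma tab_in_tab_span: "disjoint_pairs s a b \<Longrightarrow> tab r s a b \<in> tab_span r s"
  unfolding tab_span_def by blast

lemma tab_span_least:
  assumes "csubsp W" "\<And>a b. disjoint_pairs s a b \<Longrightarrow> tab r s a b \<in> W"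
  shows "tab_span r s \<subseteq> W"
  unfolding tab_span_def using assms by blast

lemma rho_add: "rho g (\<lambda>x. f x + h x) = (\<lambda>x. rho g f x + rho g h x)"
  and rho_scale: "rho g (\<lambda>x. c * f x) = (\<lambda>x. c * rho g f x)"
  and rho_zero: "rho g (\<lambda>x. 0) = (\<lambda>x. 0)"
  by (simp_all add: rho_def)

lemma G_subspace_tab_span: "G_subspace (tab_span r s)"
  unfolding G_subspace_def G_invariant_def
proof (intro conjI csubsp_tab_span allI impI ballI)
  fix g :: "'a \<Rightarrow> 'a" and f :: "'a L2"
  assume g: "bij g" and f: "f \<in> tab_span r s"
  have "tab_span r s \<subseteq> {f. rho g f \<in> tab_span r s}"
  proof (rule tab_span_least)
    show "csubsp {f. rho g f \<in> tab_span r s}"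
      by (simp add: csubsp_def[of "{f. rho g f \<in> tab_span r s}"] rho_add rho_scale rho_zero
        csubsp_zero[OF csubsp_tab_span] csubsp_add[OF csubsp_tab_span] csubsp_scale[OF csubsp_tab_span])
    fix a b :: "nat \<Rightarrow> 'a" assume "disjoint_pairs s a b"
    then show "tab r s a b \<in> {f. rho g f \<in> tab_span r s}"
      using disjoint_pairs_comp[OF _ g] by (simp add: rho_tab[OF g] tab_in_tab_span)
  qed
  then show "rho g f \<in> tab_span r s" using f by blast
qed

lemma csubsp_layer: "csubsp (L2_layer r)"
  by (simp add: csubsp_def L2_layer_def)

lemma tab_span_layer: "tab_span r s \<subseteq> L2_layer r"
  by (rule tab_span_least[OF csubsp_layer tab_layer])

lemma specht_eq_tab_span: "(specht s :: 'a::finite L2 set) = tab_span s s"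
proof -
  have "{polytabloid s a b | a b :: nat \<Rightarrow> 'a. inj_on (\<lambda>j. if j < s then a j else b (j - s)) {..<2*s}} =
      {tab s s a b | a b. disjoint_pairs s a b}"
    unfolding disjoint_pairs_iff[symmetric] using polytabloid_eq_tab by metis
  then show ?thesis by (simp add: specht_def tab_span_def)
qed

section \<open>Irreducibility and uniqueness of the components\<close>

lemma layer_op_zero: "layer_op m r1 r2 (\<lambda>x. 0) = (\<lambda>x. 0)"
  by (auto simp: layer_op_def)

lemma csubsp_layer_op_vimage:
  assumes "csubsp W"
  shows "csubsp {f. layer_op m r1 r2 f \<in> W}"
  using assms by (simp add: csubsp_def[of "{f. layer_op m r1 r2 f \<in> W}"] layer_op_zero layer_op_add layer_op_scale
    csubsp_zero csubsp_add csubsp_scale)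

lemma csubsp_trivial: "csubsp {\<lambda>x. 0}"
  by (simp add: csubsp_def)

lemma tab_span_subset_if_tab:
  fixes a :: "nat \<Rightarrow> 'a::finite"
  assumes W: "G_subspace W" and ab: "disjoint_pairs s a b" "tab r s a b \<in> W"
  shows "tab_span r s \<subseteq> W"
proof (rule tab_span_least)
  show "csubsp W" using W by (simp add: G_subspace_def)
  fix a' b' :: "nat \<Rightarrow> 'a" assume "disjoint_pairs s a' b'"
  then obtain g where g: "bij g" "\<And>i. i < s \<Longrightarrow> g (a i) = a' i" "\<And>i. i < s \<Longrightarrow> g (b i) = b' i"
    using disjoint_pairs_transitive[OF ab(1)] by metis
  have "tab r s a' b' = rho g (tab r s a b)"
    unfolding rho_tab[OF g(1)] by (rule tab_cong) (use g in auto)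
  then show "tab r s a' b' \<in> W" using G_subspace_rho[OF W g(1) ab(2)] by simp
qed

lemma NN_diag: "r \<le> n \<Longrightarrow> s \<le> NN n r r \<longleftrightarrow> s \<le> r \<and> r + s \<le> n"
  by (auto simp: NN_def)

lemma hahn_op_tab_span_other:
  assumes "t \<noteq> s" "t \<le> NN (card (UNIV :: 'a::finite set)) r1 r2"
    "r1 \<le> card (UNIV :: 'a set)" "r2 \<le> card (UNIV :: 'a set)" and f: "(f :: 'a L2) \<in> tab_span r1 s"
  shows "hahn_op r1 r2 t f = (\<lambda>x. 0)"
proof -
  have "tab_span r1 s \<subseteq> {f :: 'a L2. hahn_op r1 r2 t f \<in> {\<lambda>x. 0}}"
    unfolding hahn_op_def
    by (rule tab_span_least[OF csubsp_layer_op_vimage[OF csubsp_trivial]])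
      (use hahn_op_tab[OF _ assms(2-4)] assms(1) in \<open>auto simp: hahn_op_def\<close>)
  then show ?thesis using f by blast
qed

text \<open>A nonzero invariant subspace contains a nonzero tab with some number t of pairs. If t
  differs from s, \<open>hahn_op r r t\<close> kills the whole span but not this tab; so t = s, and
  transitivity yields all generators.\<close>

lemma G_irreducible_tab_span:
  assumes "s \<le> r" "r + s \<le> card (UNIV :: 'a::finite set)"
  shows "G_irreducible (tab_span r s :: 'a L2 set)"
  unfolding G_irreducible_def
proof (intro conjI allI impI)
  let ?n = "card (UNIV :: 'a set)"
  show "G_subspace (tab_span r s :: 'a L2 set)" by (rule G_subspace_tab_span)
  obtain a b :: "nat \<Rightarrow> 'a" where ab: "disjoint_pairs s a b"
    by (rule disjoint_pairs_exist[of s]) (use assms in auto)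
  obtain x where "card x = r" "b ` {..<s} \<subseteq> x" "a ` {..<s} \<inter> x = {}"
    using reference_set_exists[OF ab assms] by blast
  then have "tab r s a b x = 1" by (rule tab_reference)
  then have "tab r s a b \<noteq> (\<lambda>x. 0)" by auto
  then show "(tab_span r s :: 'a L2 set) \<noteq> {\<lambda>x. 0}" using tab_in_tab_span[OF ab, of r] by blast
  fix W :: "'a L2 set" assume W: "W \<subseteq> tab_span r s \<and> G_subspace W"
  show "W = {\<lambda>x. 0} \<or> W = tab_span r s"
  proof (rule disjCI)
    assume ne: "W \<noteq> tab_span r s"
    show "W = {\<lambda>x. 0}"
    proof (rule ccontr)
      assume "W \<noteq> {\<lambda>x. 0}"
      moreover have "(\<lambda>x. 0) \<in> W" using W csubsp_zero by (auto simp: G_subspace_def)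
      ultimately obtain f y where f: "f \<in> W" "f y \<noteq> 0" by fastforce
      have WL: "W \<subseteq> L2_layer r" using W tab_span_layer by blast
      obtain t a b x where t: "disjoint_pairs t a b" "tab r t a b \<in> W" "tab r t a b x \<noteq> 0"
        using tab_in_invariant_subspace[OF conjunct2[OF W] WL f] by metis
      have r: "r \<le> ?n" using assms by simp
      have N: "t \<le> NN ?n r r" using tab_nonzero_bound[OF t(1,3)] r by (simp add: NN_diag)
      have "t = s"
      proof (rule ccontr)
        assume "t \<noteq> s"
        then have "hahn_op r r t (tab r t a b) x = 0"
          using hahn_op_tab_span_other[OF _ N r r, of s "tab r t a b"] t(2) W by (simp add: subset_iff)
        then show False
          using hahn_op_tab[OF t(1) N r r] hahn_eigenvalue_pos[OF N r r] t(3) by simp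
      qed
      then show False using tab_span_subset_if_tab[OF conjunct2[OF W] t(1,2)] W ne by blast
    qed
  qed
qed

text \<open>The intertwiner is \<open>hahn_op r s s\<close>, which multiplies tabs by a nonzero
  scalar. Its kernel is a proper invariant subspace of an irreducible one, and its image contains
  the generators.\<close>

lemma G_isomorphic_tab_span_specht:
  assumes "s \<le> r" "r + s \<le> card (UNIV :: 'a::finite set)"
  shows "G_isomorphic (tab_span r s :: 'a L2 set) (specht s)"
  unfolding G_isomorphic_def specht_eq_tab_span
proof (intro exI conjI allI ballI impI)
  let ?n = "card (UNIV :: 'a set)" and ?T = "hahn_op r s s :: 'a L2 \<Rightarrow> 'a L2"
  let ?V = "tab_span r s :: 'a L2 set"
  have N: "s \<le> NN ?n r s" "r \<le> ?n" "s \<le> ?n" using assms by (auto simp: NN_def)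
  note T = hahn_op_tab[OF _ N]
  define e where "e = complex_of_real (hahn_eigenvalue ?n r s s)"
  have e: "e \<noteq> 0" using hahn_eigenvalue_pos[OF N] by (simp add: e_def)
  have Ttab: "?T (tab r s a b) = (\<lambda>x. e * tab s s a b x)" if "disjoint_pairs s a b" for a b
    using T[OF that] by (simp add: e_def)
  show add: "?T (\<lambda>x. f x + h x) = (\<lambda>x. ?T f x + ?T h x)" for f h
    unfolding hahn_op_def by (rule layer_op_add)
  show scale: "?T (\<lambda>x. c * f x) = (\<lambda>x. c * ?T f x)" for c f
    unfolding hahn_op_def by (rule layer_op_scale)
  show rho: "?T (rho g f) = rho g (?T f)" if "bij g" for g f
    unfolding hahn_op_def by (rule layer_op_rho[OF that])
  show "bij_betw ?T ?V (tab_span s s)"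
  proof (rule bij_betw_imageI)
    define W where "W = {f \<in> ?V. ?T f = (\<lambda>x. 0)}"
    have "G_subspace W"
      using G_subspace_tab_span[of r s, where 'a = 'a] layer_op_zero
      by (auto simp: W_def G_subspace_def csubsp_def G_invariant_def add scale rho rho_zero)
        (simp add: hahn_op_def layer_op_zero)
    moreover have "W \<subseteq> ?V" by (auto simp: W_def)
    moreover have "W \<noteq> ?V"
    proof
      assume W: "W = ?V"
      obtain a b :: "nat \<Rightarrow> 'a" where ab: "disjoint_pairs s a b"
        by (rule disjoint_pairs_exist[of s]) (use assms in auto)
      obtain x where "card x = s" "b ` {..<s} \<subseteq> x" "a ` {..<s} \<inter> x = {}"
        using reference_set_exists[OF ab, of s] assms by auto
      then have "tab s s a b x = 1" by (rule tab_reference)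
      moreover have "tab r s a b \<in> W" using tab_in_tab_span[OF ab, of r] W by simp
      then have "?T (tab r s a b) x = 0" by (simp add: W_def)
      ultimately show False using Ttab[OF ab] e by simp
    qed
    ultimately have W: "W = {\<lambda>x. 0}" using G_irreducible_tab_span[OF assms] unfolding G_irreducible_def by blast
    show "inj_on ?T ?V"
    proof (rule inj_onI)
      fix f h assume fh: "f \<in> ?V" "h \<in> ?V" "?T f = ?T h"
      have "(\<lambda>x. f x + (-1) * h x) \<in> ?V" using fh csubsp_tab_span by (intro csubsp_add csubsp_scale) auto
      moreover have "?T (\<lambda>x. f x + (-1) * h x) = (\<lambda>x. 0)"
        unfolding add scale using fh(3) by simp
      ultimately have "(\<lambda>x. f x + (-1) * h x) \<in> W" by (simp add: W_def)
      then show "f = h" using W by (simp add: fun_eq_iff)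
    qed
    show "?T ` ?V = tab_span s s"
    proof
      have "?V \<subseteq> {f. ?T f \<in> tab_span s s}"
        unfolding hahn_op_def
        by (rule tab_span_least[OF csubsp_layer_op_vimage[OF csubsp_tab_span]])
          (use Ttab csubsp_scale[OF csubsp_tab_span tab_in_tab_span] in \<open>simp add: hahn_op_def\<close>)
      then show "?T ` ?V \<subseteq> tab_span s s" by blast
      show "tab_span s s \<subseteq> ?T ` ?V"
      proof (rule tab_span_least)
        show "csubsp (?T ` ?V)"
          unfolding csubsp_def
        proof (intro conjI ballI allI)
          show "(\<lambda>x. 0) \<in> ?T ` ?V"
            using csubsp_zero[OF csubsp_tab_span, of r s] by (force simp: hahn_op_def layer_op_zero)
          fix f assume "f \<in> ?T ` ?V"
          then obtain f' where f': "f' \<in> ?V" "f = ?T f'" by auto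
          show "(\<lambda>x. c * f x) \<in> ?T ` ?V" for c
            using csubsp_scale[OF csubsp_tab_span f'(1), of c] scale[of c f'] f'(2) by (metis imageI)
          fix h assume "h \<in> ?T ` ?V"
          then obtain h' where h': "h' \<in> ?V" "h = ?T h'" by auto
          show "(\<lambda>x. f x + h x) \<in> ?T ` ?V"
            using csubsp_add[OF csubsp_tab_span f'(1) h'(1)] add[of f' h'] f'(2) h'(2) by (metis imageI)
        qed
        fix a b :: "nat \<Rightarrow> 'a" assume ab: "disjoint_pairs s a b"
        have "?T (\<lambda>x. (1/e) * tab r s a b x) = tab s s a b"
          unfolding scale Ttab[OF ab] using e by simp
        then show "tab s s a b \<in> ?T ` ?V"
          using csubsp_scale[OF csubsp_tab_span tab_in_tab_span[OF ab, of r], of "1/e"] by (metis imageI)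
      qed
    qed
  qed
qed

text \<open>The preimage of a tab under the isomorphism has the same symmetries, hence is a multiple
  of the tab on level r. So V contains \<open>tab_span r s\<close>, and irreducibility gives
  equality.\<close>

lemma irreducible_isomorphic_specht_unique:
  fixes V :: "'a::finite L2 set"
  assumes s: "s \<le> r" "r + s \<le> card (UNIV :: 'a set)"
    and V: "V \<subseteq> L2_layer r" "G_irreducible V" "G_isomorphic V (specht s)"
  shows "V = tab_span r s"
proof -
  obtain T where T: "bij_betw T V (tab_span s s)"
      and add: "\<And>f h. f \<in> V \<Longrightarrow> h \<in> V \<Longrightarrow> T (\<lambda>x. f x + h x) = (\<lambda>x. T f x + T h x)"
      and scale: "\<And>c f. f \<in> V \<Longrightarrow> T (\<lambda>x. c * f x) = (\<lambda>x. c * T f x)"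
      and rho: "\<And>g f. bij g \<Longrightarrow> f \<in> V \<Longrightarrow> T (rho g f) = rho g (T f)"
    using V(3) unfolding G_isomorphic_def specht_eq_tab_span by blast
  have GV: "G_subspace V" using V(2) by (simp add: G_irreducible_def)
  then have cV: "csubsp V" by (simp add: G_subspace_def)
  have inj: "inj_on T V" using T by (simp add: bij_betw_def)
  obtain a b :: "nat \<Rightarrow> 'a" where ab: "disjoint_pairs s a b"
    by (rule disjoint_pairs_exist[of s]) (use s in auto)
  obtain f where f: "f \<in> V" "T f = tab s s a b"
    using T tab_in_tab_span[OF ab, of s] unfolding bij_betw_def by (metis imageE)
  \<comment> \<open>Since T is injective and equivariant, each sign rule of the tab under a swap
    pulls back to f.\<close>
  have swap: "f (transpose u v ` x) = c * f x"
    if "\<And>x. tab s s a b (transpose u v ` x) = c * tab s s a b x" for u v c x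
  proof -
    have "T (rho (transpose u v) f) = T (\<lambda>x. c * f x)"
      unfolding rho[OF bij_transpose f(1)] scale[OF f(1)] f(2) using that by (simp add: rho_transpose)
    then have "rho (transpose u v) f = (\<lambda>x. c * f x)"
      using inj_onD[OF inj] G_subspace_rho[OF GV bij_transpose f(1)] csubsp_scale[OF cV f(1)] by blast
    then show ?thesis by (simp add: rho_transpose fun_eq_iff)
  qed
  have "skew s a b f"
    unfolding skew_def using swap[where c = "-1"] skew_tab[OF ab, of s] by (simp add: skew_def)
  moreover have "symmetric_off s a b f"
    unfolding symmetric_off_def using swap[where c = 1] symmetric_off_tab[of s a b s] by (simp add: symmetric_off_def)
  ultimately obtain c where c: "f = (\<lambda>x. c * tab r s a b x)"
    using skew_symmetric_eq_tab[OF ab] f(1) V(1) by blast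
  obtain x where "card x = s" "b ` {..<s} \<subseteq> x" "a ` {..<s} \<inter> x = {}"
    using reference_set_exists[OF ab, of s] s by auto
  then have x: "tab s s a b x = 1" by (rule tab_reference)
  have "c \<noteq> 0"
  proof
    assume "c = 0"
    then have "T f = (\<lambda>x. 0 * T f x)" using scale[OF f(1), of 0] c by simp
    then show False using x f(2) by (simp add: fun_eq_iff)
  qed
  then have "tab r s a b \<in> V" using csubsp_scale[OF cV f(1), of "1/c"] by (simp add: c)
  then have "tab_span r s \<subseteq> V" by (rule tab_span_subset_if_tab[OF GV ab])
  moreover have "(tab_span r s :: 'a L2 set) \<noteq> {\<lambda>x. 0}"
    using G_irreducible_tab_span[OF s] by (simp add: G_irreducible_def)
  ultimately show ?thesis using V(2) G_subspace_tab_span unfolding G_irreducible_def by metis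
qed

lemma L2_comp_eq_tab_span:
  assumes "s \<le> r" "r + s \<le> card (UNIV :: 'a::finite set)"
  shows "(L2_comp r s :: 'a L2 set) = tab_span r s"
  unfolding L2_comp_def
  by (rule the_equality)
    (use tab_span_layer G_irreducible_tab_span[OF assms] G_isomorphic_tab_span_specht[OF assms]
      irreducible_isomorphic_specht_unique[OF assms] in blast)+

subsection \<open>The Fourier transform\<close>

lemma inner2_tab: "inner2 f (tab r s a b) = pairing f (tab r s a b)"
  by (simp add: inner2_def pairing_def cnj_tab)

text \<open>On a single level the shift in the adjoint is 0, so \<open>hahn_op r r s\<close> is
  symmetric. Its scalars on the two kinds of tabs are 0 and nonzero, which forces
  orthogonality.\<close>

lemma tab_orth_tab_span:
  fixes a :: "nat \<Rightarrow> 'a::finite"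
  assumes "t \<noteq> s" and D: "disjoint_pairs t a b" and s: "s \<le> r" "r + s \<le> card (UNIV :: 'a set)"
  shows "tab r t a b \<in> orth (tab_span r s)"
proof -
  let ?n = "card (UNIV :: 'a set)"
  have r: "r \<le> ?n" and N: "s \<le> NN ?n r r" using s by (auto simp: NN_diag)
  have "tab_span r s \<subseteq> {\<phi>. inner2 (tab r t a b) \<phi> = 0}"
  proof (rule tab_span_least)
    show "csubsp {\<phi>. inner2 (tab r t a b) \<phi> = 0}"
      by (auto simp: csubsp_def inner2_def algebra_simps sum.distrib simp flip: sum_distrib_left)
    fix a' b' :: "nat \<Rightarrow> 'a" assume D': "disjoint_pairs s a' b'"
    have "pairing (hahn_op r r s (tab r t a b)) (tab r s a' b') = pairing (tab r t a b) (hahn_op r r s (tab r s a' b'))"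
      unfolding hahn_op_def layer_op_adjoint by simp
    then have "hahn_eigenvalue ?n r r s * pairing (tab r t a b) (tab r s a' b') = 0"
      unfolding hahn_op_tab[OF D N r r] hahn_op_tab[OF D' N r r] pairing_scale using assms(1) by simp
    then show "tab r s a' b' \<in> {\<phi>. inner2 (tab r t a b) \<phi> = 0}"
      using hahn_eigenvalue_pos[OF N r r] by (simp add: inner2_tab)
  qed
  then show ?thesis by (auto simp: orth_def)
qed

text \<open>Comparison principle: applied to a difference of kernels, it shows that scalars on tabs
  determine a layer operator.\<close>

lemma layer_op_eq_0:
  fixes f :: "'a::finite L2"
  assumes "\<And>t (a :: nat \<Rightarrow> 'a) b. disjoint_pairs t a b \<Longrightarrow> t \<le> NN (card (UNIV :: 'a set)) r1 r2 \<Longrightarrow>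
    layer_op m r1 r2 (tab r1 t a b) = (\<lambda>x. 0)"
  shows "layer_op m r1 r2 f x = 0"
proof (rule ccontr)
  assume "layer_op m r1 r2 f x \<noteq> 0"
  then obtain t y and a b :: "nat \<Rightarrow> 'a" where t: "disjoint_pairs t a b" "layer_op m r1 r2 (tab r1 t a b) y \<noteq> 0"
    using layer_op_detected_by_tab by metis
  then show False using assms[OF t(1) layer_op_tab_nonzero_bound[OF t]] by simp
qed

text \<open>The three bounds describe the domain of kernels. The second set takes r2 - k points of
  the first and k points outside it.\<close>

lemma sets_with_diff_card_exist:
  assumes "k \<le> r2" "r2 \<le> k + r1" "k + r1 \<le> card (UNIV :: 'a::finite set)"
  obtains x1 x2 :: "'a::finite set" where "card x1 = r1" "card x2 = r2" "card (x2 - x1) = k"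
proof -
  obtain x1 :: "'a set" where x1: "card x1 = r1"
    by (rule obtain_subset_with_card_n[of r1 "UNIV :: 'a set"]) (use assms in auto)
  obtain A where A: "A \<subseteq> x1" "card A = r2 - k"
    by (rule obtain_subset_with_card_n[of "r2 - k" x1]) (use assms x1 in auto)
  have "card (- x1) = card (UNIV :: 'a set) - r1" using x1 by (simp add: Compl_eq_Diff_UNIV card_Diff_subset)
  then obtain B where B: "B \<subseteq> - x1" "card B = k"
    by (metis obtain_subset_with_card_n assms(3) add_le_imp_le_diff)
  have "card (A \<union> B) = r2" using A B assms by (subst card_Un_disjoint) auto
  moreover have "A \<union> B - x1 = B" using A B by auto
  ultimately show ?thesis using that x1 B by metis
qed

text \<open>Applied to the indicator of a single set, the operator returns a kernel value.\<close>

lemma layer_op_kernel_eq_0: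
  assumes "\<And>(f :: 'a::finite L2) x. layer_op m r1 r2 f x = 0"
    and k: "k \<le> r2" "r2 \<le> k + r1" "k + r1 \<le> card (UNIV :: 'a set)"
  shows "m k = 0"
proof -
  obtain x1 x2 :: "'a set" where x: "card x1 = r1" "card x2 = r2" "card (x2 - x1) = k"
    using sets_with_diff_card_exist[OF k] by metis
  have "layer_op m r1 r2 (\<lambda>x. of_bool (x = x1)) x2 = (\<Sum>x\<in>{x1}. m (card (x2 - x)))"
    unfolding layer_op_def using x by (auto intro!: sum.mono_neutral_cong_right)
  then show ?thesis using assms(1)[of "\<lambda>x. of_bool (x = x1)" x2] x by simp
qed

text \<open>Resolves the definite description. For a competing polynomial p, subtracting the
  multiple of the Hahn polynomial with the same scalar on tabs of s pairs leaves an operator that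
  kills every tab. Its kernel has too many zeros for its degree, and the value 1 at 0 fixes the
  multiple.\<close>

lemma Lambda_eq_hahn_op:
  defines "n \<equiv> card (UNIV :: 'a::finite set)"
  assumes r: "r1 \<le> n" "r2 \<le> n" and s: "s \<le> NN n r1 r2"
  shows "(Lambda r1 r2 s :: 'a L2 \<Rightarrow> 'a L2) = hahn_op r1 r2 s"
proof -
  have b1: "s \<le> r1" "r1 + s \<le> card (UNIV :: 'a set)" and b2: "s \<le> r2" "r2 + s \<le> card (UNIV :: 'a set)"
    using s r by (auto simp: NN_def n_def)
  note hop = hahn_op_tab[where 'a = 'a, folded n_def, OF _ s r]
  define e where "e = complex_of_real (hahn_eigenvalue n r1 r2 s)"
  have e: "e \<noteq> 0" using hahn_eigenvalue_pos[OF s r] by (simp add: e_def)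
  have maps: "layer_op m r1 r2 \<psi> \<in> tab_span r2 s" if "(\<psi> :: 'a L2) \<in> tab_span r1 s" for m \<psi>
  proof -
    have "tab_span r1 s \<subseteq> {f :: 'a L2. layer_op m r1 r2 f \<in> tab_span r2 s}"
    proof (rule tab_span_least[OF csubsp_layer_op_vimage[OF csubsp_tab_span]])
      fix a b :: "nat \<Rightarrow> 'a" assume D: "disjoint_pairs s a b"
      show "tab r1 s a b \<in> {f. layer_op m r1 r2 f \<in> tab_span r2 s}"
        using layer_op_tab_ex[OF D, of m r1 r2] csubsp_scale[OF csubsp_tab_span tab_in_tab_span[OF D, of r2]] by auto
    qed
    then show ?thesis using that by blast
  qed
  have vanish: "hahn_op r1 r2 s \<psi> = (\<lambda>x. 0)" if \<psi>: "(\<psi> :: 'a L2) \<in> orth (tab_span r1 s)" for \<psi>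
  proof (rule ccontr)
    assume "hahn_op r1 r2 s \<psi> \<noteq> (\<lambda>x. 0)"
    then obtain y where "hahn_op r1 r2 s \<psi> y \<noteq> 0" by auto
    then obtain t a b x where t: "disjoint_pairs t a b" "pairing \<psi> (tab r1 t a b) \<noteq> 0"
        "hahn_op r1 r2 s (tab r1 t a b) x \<noteq> 0"
      using layer_op_detected_by_tab unfolding hahn_op_def by metis
    have "t = s" using t(3) unfolding hop[OF t(1)] by (simp split: if_splits)
    then have "inner2 \<psi> (tab r1 t a b) = 0" using \<psi> tab_in_tab_span t(1) unfolding orth_def by blast
    then show False using t(2) by (simp add: inner2_tab)
  qed
  have unique: "p = hahn n r1 r2 s"
    if p: "degree p = s" "poly p 0 = 1"
      and van: "\<And>\<psi> :: 'a L2. \<psi> \<in> orth (tab_span r1 s) \<Longrightarrow> layer_op (\<lambda>k. poly p (of_nat k)) r1 r2 \<psi> = (\<lambda>x. 0)" for p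
  proof -
    let ?L = "layer_op (\<lambda>k. poly p (of_nat k)) r1 r2 :: 'a L2 \<Rightarrow> 'a L2"
    obtain a0 b0 :: "nat \<Rightarrow> 'a" where D0: "disjoint_pairs s a0 b0"
      by (rule disjoint_pairs_exist[of s]) (use b1 in auto)
    obtain c where c: "?L (tab r1 s a0 b0) = (\<lambda>x. c * tab r2 s a0 b0 x)"
      using layer_op_tab_ex[OF D0] by blast
    \<comment> \<open>By transitivity and equivariance the scalar c does not depend on the choice of
      the s pairs.\<close>
    have L: "?L (tab r1 s a b) = (\<lambda>x. c * tab r2 s a b x)" if D: "disjoint_pairs s a b" for a b
    proof -
      obtain g where g: "bij g" "\<And>i. i < s \<Longrightarrow> g (a0 i) = a i" "\<And>i. i < s \<Longrightarrow> g (b0 i) = b i"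
        using disjoint_pairs_transitive[OF D0 D] by metis
      have tab: "tab r s a b = rho g (tab r s a0 b0)" for r
        unfolding rho_tab[OF g(1)] by (rule tab_cong) (use g in auto)
      show ?thesis unfolding tab layer_op_rho[OF g(1)] c by (simp add: rho_scale)
    qed
    define q where "q = p - smult (c / e) (hahn n r1 r2 s)"
    \<comment> \<open>The difference is written as a two-term sum to fit
      \<open>layer_op_kernel_sum\<close>.\<close>
    have kernel: "(\<lambda>k. poly q (of_nat k)) =
        (\<lambda>k. \<Sum>j\<in>{0, 1 :: nat}. (if j = 0 then 1 else - (c / e)) * poly (if j = 0 then p else hahn n r1 r2 s) (of_nat k))"
      by (simp add: q_def)
    have op: "layer_op (\<lambda>k. poly q (of_nat k)) r1 r2 f x = ?L f x - c / e * hahn_op r1 r2 s f x" for f :: "'a L2" and x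
      unfolding kernel layer_op_kernel_sum by (simp add: hahn_op_def n_def)
    have "layer_op (\<lambda>k. poly q (of_nat k)) r1 r2 f x = 0" for f :: "'a L2" and x
    proof (rule layer_op_eq_0)
      fix t and a b :: "nat \<Rightarrow> 'a" assume D: "disjoint_pairs t a b"
      show "layer_op (\<lambda>k. poly q (of_nat k)) r1 r2 (tab r1 t a b) = (\<lambda>x. 0)"
      proof (cases "t = s")
        case True
        then show ?thesis unfolding fun_eq_iff op hop[OF D] using L D e by (simp add: e_def)
      next
        case False
        then show ?thesis
          unfolding fun_eq_iff op hop[OF D] using van[OF tab_orth_tab_span[OF False D b1]] by simp
      qed
    qed
    note q0 = layer_op_kernel_eq_0[OF this]
    have "q = 0"
    proof (rule ccontr)
      assume "q \<noteq> 0"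
      define N where "N = NN n r1 r2"
      \<comment> \<open>Truncated subtraction makes \<open>r2 - r1\<close> the left end of the
        kernel domain, which consists of exactly N + 1 integers; the degree of \<open>q\<close> is
        at most s, hence at most N.\<close>
      let ?S = "(\<lambda>i. complex_of_nat ((r2 - r1) + i)) ` {..N}"
      have "?S \<subseteq> {z. poly q z = 0}"
        using r by (auto simp del: of_nat_add simp: N_def NN_def n_def intro!: q0)
      then have "card ?S \<le> card {z. poly q z = 0}"
        using poly_roots_finite[OF \<open>q \<noteq> 0\<close>] by (rule card_mono[rotated])
      also have "\<dots> \<le> degree q" by (rule card_poly_roots_bound[OF \<open>q \<noteq> 0\<close>])
      also have "\<dots> \<le> s"
        unfolding q_def using p(1) degree_hahn[OF s]
        by (intro degree_diff_le order_trans[OF degree_smult_le]) auto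
      finally have "card ?S \<le> N" using s by (simp add: N_def)
      moreover have "inj_on (\<lambda>i. complex_of_nat ((r2 - r1) + i)) {..N}"
        by (rule inj_onI) (simp del: of_nat_add)
      then have "card ?S = Suc N" by (simp only: card_image card_atMost)
      ultimately show False by simp
    qed
    then have pq: "p = smult (c / e) (hahn n r1 r2 s)" by (simp add: q_def)
    then have "c / e = 1" using p(2) by (simp add: poly_hahn_0)
    then show ?thesis using pq by simp
  qed
  show ?thesis
    unfolding Lambda_def L2_comp_eq_tab_span[OF b1] L2_comp_eq_tab_span[OF b2]
  proof (rule the_equality)
    show "\<exists>p. degree p = s \<and> poly p 0 = 1 \<and>
      hahn_op r1 r2 s = (\<lambda>\<psi> x2. if card x2 = r2
         then (\<Sum>x1\<in>{x :: 'a set. card x = r1}. poly p (of_nat (card (x2 - x1))) * \<psi> x1) else 0)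
      \<and> (\<forall>\<psi> :: 'a L2 \<in> tab_span r1 s. hahn_op r1 r2 s \<psi> \<in> tab_span r2 s)
      \<and> (\<forall>\<psi> :: 'a L2 \<in> orth (tab_span r1 s). hahn_op r1 r2 s \<psi> = (\<lambda>x. 0))"
    proof (intro exI[of _ "hahn n r1 r2 s"] conjI ballI)
      show "hahn_op r1 r2 s = (\<lambda>\<psi> x2. if card x2 = r2
         then (\<Sum>x1\<in>{x :: 'a set. card x = r1}. poly (hahn n r1 r2 s) (of_nat (card (x2 - x1))) * \<psi> x1) else 0)"
        unfolding hahn_op_def layer_op_def n_def ..
      show "hahn_op r1 r2 s \<psi> \<in> tab_span r2 s" if "\<psi> \<in> tab_span r1 s" for \<psi> :: "'a L2"
        unfolding hahn_op_def by (rule maps[OF that])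
    qed (use degree_hahn[OF s] poly_hahn_0 vanish in auto)
    fix L :: "'a L2 \<Rightarrow> 'a L2"
    assume "\<exists>p. degree p = s \<and> poly p 0 = 1 \<and>
      L = (\<lambda>\<psi> x2. if card x2 = r2
         then (\<Sum>x1\<in>{x. card x = r1}. poly p (of_nat (card (x2 - x1))) * \<psi> x1) else 0)
      \<and> (\<forall>\<psi>\<in>tab_span r1 s. L \<psi> \<in> tab_span r2 s)
      \<and> (\<forall>\<psi>\<in>orth (tab_span r1 s). L \<psi> = (\<lambda>x. 0))"
    then obtain p where p: "degree p = s" "poly p 0 = 1"
      and L: "L = layer_op (\<lambda>k. poly p (of_nat k)) r1 r2"
      and van: "\<And>\<psi>. \<psi> \<in> orth (tab_span r1 s) \<Longrightarrow> L \<psi> = (\<lambda>x. 0)"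
      unfolding layer_op_def by blast
    show "L = hahn_op r1 r2 s"
      using unique[OF p van[unfolded L]] L by (simp add: hahn_op_def n_def)
  qed
qed

text \<open>The square roots in \<open>kcoef\<close> and \<open>alpha\<close> combine to the
  reciprocal of the binomial in the eigenvalue; the other factors of \<open>alpha\<close> are
  reciprocal to the rest of it.\<close>

lemma kcoef_alpha_eigenvalue:
  assumes "s \<le> NN n r1 r2" "r1 \<le> n" "r2 \<le> n"
  shows "kcoef n r1 r2 s * alpha n r1 r2 s * hahn_eigenvalue n r1 r2 s =
    (-2) ^ s * krawtchouk (r1 - s) (r2 - s) (n - 2 * s)"
proof -
  have b: "s \<le> n - s + 1" "s \<le> r2" "s \<le> n - r1" "r1 - s \<le> n - 2 * s" "r2 - s \<le> n - 2 * s"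
    using assms by (auto simp: NN_def)
  define A B where "A = real ((n - 2 * s) choose (r1 - s))" and "B = real ((n - 2 * s) choose (r2 - s))"
  have AB: "A > 0" "B > 0" using b by (simp_all add: A_def B_def)
  define F G H where "F = ffac (real (n - s + 1)) s" and "G = ffac (real r2) s" and "H = ffac (real (n - r1)) s"
  have F: "F > 0" "G > 0" "H > 0" unfolding F_def G_def H_def using b by (simp_all only: ffac_pos)
  have "sqrt (B / A) / sqrt (A * B) = 1 / A"
  proof -
    have "sqrt (B / A) / sqrt (A * B) = sqrt ((1 / A) ^ 2)"
      using AB by (simp add: real_sqrt_divide[symmetric] power2_eq_square)
    then show ?thesis using AB by simp
  qed
  then have "sqrt (B / A) = sqrt (A * B) / A" using AB by (simp add: field_simps)
  then show ?thesis
    using AB F unfolding kcoef_def alpha_def hahn_eigenvalue_def A_def[symmetric] B_def[symmetric]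
      F_def[symmetric] G_def[symmetric] H_def[symmetric]
    by (simp add: field_simps)
qed

text \<open>Both sides have the same scalar on every tab, so the comparison principle applies to the
  difference of their kernels.\<close>

lemma layer_op_sign_decomposition:
  fixes \<psi> :: "'a::finite L2"
  defines "n \<equiv> card (UNIV :: 'a set)"
  assumes r: "r1 \<le> n" "r2 \<le> n"
  shows "layer_op (\<lambda>k. (-1) ^ (r2 + k)) r1 r2 \<psi> x =
    (\<Sum>s\<le>NN n r1 r2. complex_of_real (kcoef n r1 r2 s * alpha n r1 r2 s) * hahn_op r1 r2 s \<psi> x)"
proof -
  let ?N = "NN n r1 r2"
  let ?c = "\<lambda>s. complex_of_real (kcoef n r1 r2 s * alpha n r1 r2 s)"
  let ?h = "\<lambda>s k. poly (hahn n r1 r2 s) (of_nat k)"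
  \<comment> \<open>The extra index \<open>Suc ?N\<close> carries the sign kernel, so the difference
    is again one finite sum of kernels.\<close>
  define m where "m = (\<lambda>k. \<Sum>j\<in>insert (Suc ?N) {..?N}. (if j = Suc ?N then 1 else - ?c j) *
      (if j = Suc ?N then (-1) ^ (r2 + k) else ?h j k))"
  have op: "layer_op m r1 r2 f y = layer_op (\<lambda>k. (-1) ^ (r2 + k)) r1 r2 f y - (\<Sum>s\<le>?N. ?c s * hahn_op r1 r2 s f y)"
    for f :: "'a L2" and y
  proof -
    have "layer_op m r1 r2 f y = (\<Sum>j\<in>insert (Suc ?N) {..?N}. (if j = Suc ?N then 1 else - ?c j) *
      layer_op (\<lambda>k. if j = Suc ?N then (-1) ^ (r2 + k) else ?h j k) r1 r2 f y)"
      unfolding m_def by (rule layer_op_kernel_sum)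
    also have "\<dots> = layer_op (\<lambda>k. (-1) ^ (r2 + k)) r1 r2 f y + (\<Sum>j\<le>?N. - ?c j * layer_op (?h j) r1 r2 f y)"
      by (subst sum.insert) (auto intro!: sum.cong)
    finally show ?thesis by (simp add: hahn_op_def n_def sum_negf)
  qed
  have "layer_op m r1 r2 \<psi> x = 0"
  proof (rule layer_op_eq_0)
    fix t and a b :: "nat \<Rightarrow> 'a"
    assume D: "disjoint_pairs t a b" and "t \<le> NN (card (UNIV :: 'a set)) r1 r2"
    then have N: "t \<le> ?N" by (simp add: n_def)
    then have t: "t \<le> r1" "t \<le> r2" "r2 + t \<le> card (UNIV :: 'a set)"
      using r by (auto simp: NN_def n_def)
    show "layer_op m r1 r2 (tab r1 t a b) = (\<lambda>x. 0)"
    proof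
      fix y
      have "(\<Sum>s\<le>?N. ?c s * hahn_op r1 r2 s (tab r1 t a b) y) = (\<Sum>s\<in>{t}. ?c s * hahn_op r1 r2 s (tab r1 t a b) y)"
        by (rule sum.mono_neutral_right) (use N hahn_op_tab[OF D, folded n_def, OF _ r] in auto)
      also have "\<dots> = of_real (kcoef n r1 r2 t * alpha n r1 r2 t * hahn_eigenvalue n r1 r2 t) * tab r2 t a b y"
        using hahn_op_tab[OF D, folded n_def, OF N r] by simp
      also have "\<dots> = of_real ((-2) ^ t * krawtchouk (r1 - t) (r2 - t) (n - 2 * t)) * tab r2 t a b y"
        unfolding kcoef_alpha_eigenvalue[OF N r] ..
      finally show "layer_op m r1 r2 (tab r1 t a b) y = 0"
        unfolding op layer_op_sign_tab[OF D t] by (simp add: n_def)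
    qed
  qed
  then show ?thesis unfolding op by simp
qed

text \<open>For fixed |x| this turns the Fourier kernel into a function of the set difference, as
  layer operators require.\<close>

lemma sign_card_Int:
  fixes x y :: "'a::finite set"
  shows "(-1 :: complex) ^ card (x \<inter> y) = (-1) ^ (card x + card (x - y))"
proof -
  have "card x + card (x - y) = card (x \<inter> y) + 2 * card (x - y)" using card_Int_Diff[of x y] by simp
  then show ?thesis by (simp add: power_add power_mult)
qed

lemma fourier_EndG: "(fourier :: 'a::finite L2 \<Rightarrow> 'a L2) \<in> EndG"
proof -
  have "is_clinear (fourier :: 'a L2 \<Rightarrow> 'a L2)"
    by (auto simp: is_clinear_def fourier_def algebra_simps sum.distrib sum_distrib_left)
  moreover have "fourier (rho g \<psi>) x = rho g (fourier \<psi>) x" if g: "bij g" for g and \<psi> :: "'a L2" and x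
  proof -
    have inj: "inj (inv g)" using g bij_imp_bij_inv bij_is_inj by blast
    have "card (inv g ` x \<inter> inv g ` y) = card (x \<inter> y)" for y
      using card_inv_image[OF g, of "x \<inter> y"] by (simp add: image_Int[OF inj])
    then have "fourier (rho g \<psi>) x = (\<Sum>y\<in>UNIV. (-1) ^ card (inv g ` x \<inter> inv g ` y) * \<psi> (inv g ` y))"
      by (simp add: fourier_def rho_def)
    also have "\<dots> = (\<Sum>y\<in>UNIV. (-1) ^ card (inv g ` x \<inter> y) * \<psi> y)"
      by (rule sum.reindex_bij_betw[OF bij_inv_image[OF g]])
    finally show ?thesis by (simp add: fourier_def rho_def)
  qed
  ultimately show ?thesis by (auto simp: EndG_def is_equivariant_def)
qed

theorem theorem4:
  fixes n :: nat
  assumes "n = card (UNIV :: 'a::finite set)"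
  shows "(fourier :: 'a L2 \<Rightarrow> 'a L2) \<in> EndG
    \<and> (\<forall>(\<psi> :: 'a L2) x. fourier \<psi> x =
        (\<Sum>r1\<le>n. \<Sum>r2\<le>n. \<Sum>s\<le>NN n r1 r2.
           complex_of_real (kcoef n r1 r2 s) * Lambda_t r1 r2 s \<psi> x))"
proof (intro conjI fourier_EndG allI)
  fix \<psi> :: "'a L2" and x
  have card_le: "card y \<le> n" for y :: "'a set" unfolding assms by (simp add: card_mono)
  \<comment> \<open>Grouping the sets y by size produces the sum over \<open>r1\<close>.\<close>
  have "fourier \<psi> x = (\<Sum>r1\<le>n. \<Sum>y\<in>{y\<in>UNIV. card y = r1}. (-1) ^ card (x \<inter> y) * \<psi> y)"
    unfolding fourier_def by (rule sum.group[symmetric]) (auto simp: card_le)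
  also have "\<dots> = (\<Sum>r1\<le>n. layer_op (\<lambda>k. (-1) ^ (card x + k)) r1 (card x) \<psi> x)"
    by (simp add: layer_op_def sign_card_Int)
  also have "\<dots> = (\<Sum>r1\<le>n. \<Sum>r2\<le>n. \<Sum>s\<le>NN n r1 r2.
      complex_of_real (kcoef n r1 r2 s) * Lambda_t r1 r2 s \<psi> x)"
  proof (rule sum.cong[OF refl])
    fix r1 assume "r1 \<in> {..n}"
    then have r1: "r1 \<le> card (UNIV :: 'a set)" by (simp add: assms)
    have L: "complex_of_real (kcoef n r1 r2 s) * Lambda_t r1 r2 s \<psi> x =
        of_real (kcoef n r1 r2 s * alpha n r1 r2 s) * hahn_op r1 r2 s \<psi> x"
      if "r2 \<le> n" "s \<le> NN n r1 r2" for r2 s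
      using Lambda_eq_hahn_op[OF r1, of r2 s] that by (simp add: Lambda_t_def assms)
    \<comment> \<open>At the point x only r2 = |x| contributes, because every operator takes values
      supported on its target layer.\<close>
    have "(\<Sum>r2\<le>n. \<Sum>s\<le>NN n r1 r2. complex_of_real (kcoef n r1 r2 s) * Lambda_t r1 r2 s \<psi> x) =
        (\<Sum>r2\<in>{card x}. \<Sum>s\<le>NN n r1 r2. of_real (kcoef n r1 r2 s * alpha n r1 r2 s) * hahn_op r1 r2 s \<psi> x)"
    proof (rule sum.mono_neutral_cong_right)
      show "\<forall>r2\<in>{..n} - {card x}. (\<Sum>s\<le>NN n r1 r2. complex_of_real (kcoef n r1 r2 s) * Lambda_t r1 r2 s \<psi> x) = 0"
        by (auto simp: L hahn_op_def layer_op_def simp del: of_real_mult mult_eq_0_iff intro!: sum.neutral)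
    qed (auto simp: L card_le simp del: of_real_mult mult_eq_0_iff)
    also have "\<dots> = layer_op (\<lambda>k. (-1) ^ (card x + k)) r1 (card x) \<psi> x"
      using layer_op_sign_decomposition[OF r1, of "card x" \<psi> x] card_le[of x] by (simp add: assms)
    finally show "layer_op (\<lambda>k. (-1) ^ (card x + k)) r1 (card x) \<psi> x =
        (\<Sum>r2\<le>n. \<Sum>s\<le>NN n r1 r2. complex_of_real (kcoef n r1 r2 s) * Lambda_t r1 r2 s \<psi> x)" by simp
  qed
  finally show "fourier \<psi> x = (\<Sum>r1\<le>n. \<Sum>r2\<le>n. \<Sum>s\<le>NN n r1 r2.
      complex_of_real (kcoef n r1 r2 s) * Lambda_t r1 r2 s \<psi> x)" .
qed

end
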